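(* Let $\rho:SL_2(\mathbb{Z})\to GL(p,\mathbb{C})$ be a representation such that all eigenvalues of $\rho(T)$ lie on the unit circle, where $T=\begin{pmatrix}1&1\\0&1\end{pmatrix}$, and let $k$ be a real number. There is a constant $\alpha$ depending only on $\rho$ such that for every holomorphic logarithmic vector-valued modular form $F\in\mathcal{H}(k,\rho)$, the Fourier coefficients $a(n)$ of $F$ satisfy $a(n)=O(n^{k+\alpha})$ as $n\to\infty$. If moreover $F$ is cuspidal, then $a(n)=O(n^{(k+\alpha)/2})$ as $n\to\infty$.
   Context: $SL_2(\mathbb{Z})$ acts on the upper half-plane $\mathfrak{H}$ by Möbius transformations. For $\gamma=\begin{pmatrix}a&b\\c&d\end{pmatrix}$ and $F:\mathfrak{H}\to\mathbb{C}^p$, set $(F|_k\gamma)(\tau)=(c\tau+d)^{-k}F(\gamma\tau)$. An (unrestricted) vector-valued modular form of weight $k$ for $\rho$ is a holomorphic $F=(f_1,\dots,f_p)^t:\mathfrak{H}\to\mathbb{C}^p$ with $\rho(\gamma)F=F|_k\gamma$ for all $\gamma\in SL_2(\mathbb{Z})$. The span $W$ of $f_1,\dots,f_p$ is invariant under $f(\tau)\mapsto f(\tau+1)$, and $W$ has a basis which is a union of chains $g_0,\dots,g_{m-1}$ satisfying $g_j(\tau+1)=\lambda(g_j(\tau)+g_{j-1}(\tau))$ ($g_{-1}=0$), with $\lambda$ an eigenvalue of $\rho(T)$ (i.e. the translation acts by a block-diagonal matrix of "modified Jordan blocks" with $\lambda$ on the diagonal and subdiagonal). Writing $\lambda=e^{2\pi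 i\mu}$ with $\mu$ real, each chain has a polynomial $q$-expansion $g_j(\tau)=\sum_{t=0}^j\binom{\tau}{t}h_{j-t}(\tau)$, where $\binom{x}{t}=x(x-1)\cdots(x-t+1)/t!$ and $h_t(\tau)=\sum_{n\in\mathbb{Z}}a_t(n)e^{2\pi i(n+\mu)\tau}$ are convergent $q$-series. The coefficients $a_t(n)$ are the Fourier coefficients of $F$. $F$ is a holomorphic logarithmic vector-valued modular form if $a_t(n)=0$ whenever $n+\mu<0$ (for all chains and all $t$), and cuspidal if $a_t(n)=0$ whenever $n+\mu\le 0$. $\mathcal{H}(k,\rho)$ denotes the space of holomorphic logarithmic vector-valued modular forms of weight $k$ for $\rho$. *)

theory Defs
  imports "HOL-Analysis.Analysis" "HOL-Library.Landau_Symbols"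
begin

definition upper_half_plane :: "complex set" where
  "upper_half_plane = {\<tau>. Im \<tau> > 0}"

definition SL2Z :: "(int^2^2) set" where
  "SL2Z = {\<gamma>. det \<gamma> = 1}"

definition T_mat :: "int^2^2" where
  "T_mat = vector [vector [1, 1], vector [0, 1]]"

text \<open>Only the values on \<^const>\<open>SL2Z\<close> matter; \<open>\<rho> (mat 1) = mat 1\<close> follows from invertibility.\<close>

definition SL2Z_representation :: "(int^2^2 \<Rightarrow> complex^'p^'p) \<Rightarrow> bool" where
  "SL2Z_representation \<rho> \<longleftrightarrow>
     (\<forall>\<gamma>\<in>SL2Z. invertible (\<rho> \<gamma>)) \<and>
     (\<forall>\<gamma>\<in>SL2Z. \<forall>\<delta>\<in>SL2Z. \<rho> (\<gamma> ** \<delta>) = \<rho> \<gamma> ** \<rho> \<delta>)"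

definition is_eigenvalue :: "complex^'p^'p \<Rightarrow> complex \<Rightarrow> bool" where
  "is_eigenvalue A z \<longleftrightarrow> (\<exists>v. v \<noteq> 0 \<and> A *v v = z *s v)"

definition moebius :: "int^2^2 \<Rightarrow> complex \<Rightarrow> complex" where
  "moebius \<gamma> \<tau> = (of_int (\<gamma>$1$1) * \<tau> + of_int (\<gamma>$1$2)) / (of_int (\<gamma>$2$1) * \<tau> + of_int (\<gamma>$2$2))"

text \<open>For non-integral weight the power is the principal branch (imaginary part of the logarithm
  in \<open>(-\<pi>, \<pi>]\<close>); for integral \<open>k\<close> it is the ordinary power, since \<open>c\<tau> + d \<noteq> 0\<close>.\<close>

definition slash :: "real \<Rightarrow> (complex \<Rightarrow> complex^'p) \<Rightarrow> int^2^2 \<Rightarrow> complex \<Rightarrow> complex^'p" where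
  "slash k F \<gamma> \<tau> =
     ((of_int (\<gamma>$2$1) * \<tau> + of_int (\<gamma>$2$2)) powr (- of_real k)) *s F (moebius \<gamma> \<tau>)"

definition vvmf :: "real \<Rightarrow> (int^2^2 \<Rightarrow> complex^'p^'p) \<Rightarrow> (complex \<Rightarrow> complex^'p) \<Rightarrow> bool" where
  "vvmf k \<rho> F \<longleftrightarrow>
     (\<forall>i. (\<lambda>\<tau>. F \<tau> $ i) holomorphic_on upper_half_plane) \<and>
     (\<forall>\<gamma>\<in>SL2Z. \<forall>\<tau>\<in>upper_half_plane. \<rho> \<gamma> *v F \<tau> = slash k F \<gamma> \<tau>)"

text \<open>A function on the upper half-plane is represented by a total function whose values
  elsewhere are irrelevant, so span and linear independence are taken for the restrictions to the
  upper half-plane.\<close>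

definition uhp_span :: "'i set \<Rightarrow> ('i \<Rightarrow> complex \<Rightarrow> complex) \<Rightarrow> (complex \<Rightarrow> complex) set" where
  "uhp_span I u = {g. \<exists>c. \<forall>\<tau>\<in>upper_half_plane. g \<tau> = (\<Sum>i\<in>I. c i * u i \<tau>)}"

definition uhp_independent :: "'i set \<Rightarrow> ('i \<Rightarrow> complex \<Rightarrow> complex) \<Rightarrow> bool" where
  "uhp_independent I u \<longleftrightarrow>
     (\<forall>c. (\<forall>\<tau>\<in>upper_half_plane. (\<Sum>i\<in>I. c i * u i \<tau>) = 0) \<longrightarrow> (\<forall>i\<in>I. c i = 0))"

definition component_space :: "(complex \<Rightarrow> complex^'p) \<Rightarrow> (complex \<Rightarrow> complex) set" where
  "component_space F = uhp_span UNIV (\<lambda>i \<tau>. F \<tau> $ i)"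

text \<open>A chain \<open>g\<^sub>0, \<dots>, g\<^sub>m\<^sub>-\<^sub>1\<close> with \<open>m = chain_length\<close>, \<open>\<mu> = exponent\<close>, \<open>g = chain_fun\<close> and
  Fourier coefficients \<open>a\<^sub>t(n) = chain_coeff t n\<close>; only indices below \<open>m\<close> are meaningful.\<close>

record log_chain =
  chain_length :: nat
  exponent :: real
  chain_fun :: "nat \<Rightarrow> complex \<Rightarrow> complex"
  chain_coeff :: "nat \<Rightarrow> int \<Rightarrow> complex"

definition chain_eigenvalue :: "log_chain \<Rightarrow> complex" where
  "chain_eigenvalue c = exp (2 * of_real pi * \<i> * of_real (exponent c))"

definition jordan_chain :: "log_chain \<Rightarrow> bool" where
  "jordan_chain c \<longleftrightarrow> chain_length c > 0 \<and>
     (\<forall>j<chain_length c. \<forall>\<tau>\<in>upper_half_plane.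
        chain_fun c j (\<tau> + 1) =
          chain_eigenvalue c * (chain_fun c j \<tau> + (if j = 0 then 0 else chain_fun c (j - 1) \<tau>)))"

definition q_series_sums :: "real \<Rightarrow> (int \<Rightarrow> complex) \<Rightarrow> (complex \<Rightarrow> complex) \<Rightarrow> bool" where
  "q_series_sums \<mu> a h \<longleftrightarrow>
     (\<forall>\<tau>\<in>upper_half_plane.
        ((\<lambda>n. a n * exp (2 * of_real pi * \<i> * of_real (of_int n + \<mu>) * \<tau>)) has_sum h \<tau>) UNIV)"

definition polynomial_q_expansion :: "log_chain \<Rightarrow> bool" where
  "polynomial_q_expansion c \<longleftrightarrow>
     (\<exists>h. (\<forall>t<chain_length c. q_series_sums (exponent c) (chain_coeff c t) (h t)) \<and>
          (\<forall>j<chain_length c. \<forall>\<tau>\<in>upper_half_plane.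
             chain_fun c j \<tau> = (\<Sum>t\<le>j. (\<tau> gchoose t) * h (j - t) \<tau>)))"

definition chain_index :: "log_chain list \<Rightarrow> (nat \<times> nat) set" where
  "chain_index C = (SIGMA r:{..<length C}. {..<chain_length (C ! r)})"

definition chain_family :: "log_chain list \<Rightarrow> nat \<times> nat \<Rightarrow> complex \<Rightarrow> complex" where
  "chain_family C = (\<lambda>(r, j). chain_fun (C ! r) j)"

definition chain_basis :: "(complex \<Rightarrow> complex^'p) \<Rightarrow> log_chain list \<Rightarrow> bool" where
  "chain_basis F C \<longleftrightarrow>
     uhp_independent (chain_index C) (chain_family C) \<and>
     uhp_span (chain_index C) (chain_family C) = component_space F"

definition log_q_expansion ::
  "(int^2^2 \<Rightarrow> complex^'p^'p) \<Rightarrow> (complex \<Rightarrow> complex^'p) \<Rightarrow> log_chain list \<Rightarrow> bool" where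
  "log_q_expansion \<rho> F C \<longleftrightarrow> chain_basis F C \<and>
     (\<forall>c\<in>set C. is_eigenvalue (\<rho> T_mat) (chain_eigenvalue c) \<and>
        jordan_chain c \<and> polynomial_q_expansion c)"

text \<open>The basis of chains and the exponents \<open>\<mu>\<close> are not unique. Holomorphy and cuspidality require the
  vanishing for some choice (it does not depend on the choice), while a Fourier coefficient sequence
  of \<open>F\<close> is one arising from any choice.\<close>

definition is_fourier_coeff ::
  "(int^2^2 \<Rightarrow> complex^'p^'p) \<Rightarrow> (complex \<Rightarrow> complex^'p) \<Rightarrow> (int \<Rightarrow> complex) \<Rightarrow> bool" where
  "is_fourier_coeff \<rho> F a \<longleftrightarrow>
     (\<exists>C. log_q_expansion \<rho> F C \<and> (\<exists>c\<in>set C. \<exists>t<chain_length c. a = chain_coeff c t))"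

definition log_holomorphic ::
  "(int^2^2 \<Rightarrow> complex^'p^'p) \<Rightarrow> (complex \<Rightarrow> complex^'p) \<Rightarrow> bool" where
  "log_holomorphic \<rho> F \<longleftrightarrow>
     (\<exists>C. log_q_expansion \<rho> F C \<and>
        (\<forall>c\<in>set C. \<forall>t<chain_length c. \<forall>n. of_int n + exponent c < 0 \<longrightarrow> chain_coeff c t n = 0))"

definition log_cuspidal ::
  "(int^2^2 \<Rightarrow> complex^'p^'p) \<Rightarrow> (complex \<Rightarrow> complex^'p) \<Rightarrow> bool" where
  "log_cuspidal \<rho> F \<longleftrightarrow>
     (\<exists>C. log_q_expansion \<rho> F C \<and>
        (\<forall>c\<in>set C. \<forall>t<chain_length c. \<forall>n. of_int n + exponent c \<le> 0 \<longrightarrow> chain_coeff c t n = 0))"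

definition hol_log_vvmf ::
  "real \<Rightarrow> (int^2^2 \<Rightarrow> complex^'p^'p) \<Rightarrow> (complex \<Rightarrow> complex^'p) set" where
  "hol_log_vvmf k \<rho> = {F. vvmf k \<rho> F \<and> log_holomorphic \<rho> F}"

end

theory Submission
  imports Defs "HOL-Computational_Algebra.Fundamental_Theorem_Algebra"
begin

text \<open>Every point of the strip \<open>\<bar>Re \<tau>\<bar> \<le> 1/2\<close> is moved into the region \<open>\<bar>Re z\<bar> \<le> 1/2\<close>, \<open>Im z \<ge> 1/2\<close> by
  steps \<open>\<tau> \<mapsto> -1/\<tau> + n\<close>. Since the eigenvalues of \<open>\<rho>(T)\<close> have modulus 1, \<open>\<rho>(T)\<^sup>n\<close> grows polynomially
  in \<open>\<bar>n\<bar>\<close>, and the costs of the steps multiply to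
  \<open>\<bar>F \<tau>\<bar> \<le> (Im z / Im \<tau>) powr (\<beta> + k/2) * \<bar>F z\<bar>\<close> with \<open>\<beta>\<close> depending only on \<open>\<rho>\<close>. The \<open>q\<close>-expansions
  bound \<open>F z\<close> by a multiple of \<open>(Im z)\<^sup>p\<close>, and by any power of \<open>Im z\<close> if \<open>F\<close> is cuspidal. Hence \<open>F\<close> is
  bounded by a power of \<open>1 / Im \<tau>\<close> on the strip, and the Fourier integral at height \<open>Im \<tau> = 1/n\<close> gives
  the estimates. If \<open>k + \<alpha> < 0\<close> and \<open>F\<close> is not cuspidal the direct estimate is too weak, but then
  \<open>F\<close> tends to 0 at the real line and all its Fourier coefficients vanish.\<close>

section \<open>Growth of matrix iterates\<close>

text \<open>The family is indexed because its members may coincide: two equal members already give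
  the relation with coefficients 1 and -1, and otherwise the image is a set with more elements than
  the dimension.\<close>

lemma linear_relation_exists:
  fixes f :: "'i \<Rightarrow> 'a::field^'p"
  assumes "finite I" "CARD('p) < card I"
  obtains c where "\<exists>i\<in>I. c i \<noteq> 0" "(\<Sum>i\<in>I. c i *s f i) = 0"
proof (cases "inj_on f I")
  case True
  have "vec.dependent (f ` I)"
  proof (rule ccontr)
    assume "\<not> vec.dependent (f ` I)"
    then have "card (f ` I) \<le> vec.dim (f ` I)"
      using vec.dim_eq_card_independent by fastforce
    also have "\<dots> \<le> vec.dim (UNIV :: ('a^'p) set)"
      by (rule vec.dim_subset) auto
    also have "\<dots> = CARD('p)"
      by (simp add: card_cart_basis vec.dim_UNIV)
    finally show False
      using assms True by (simp add: card_image)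
  qed
  then obtain u where u: "\<exists>v\<in>f ` I. u v \<noteq> 0" "(\<Sum>v\<in>f ` I. u v *s v) = 0"
    using iffD1[OF vec.dependent_finite[of "f ` I"]] assms(1) by auto
  show ?thesis
    by (rule that[of "u \<circ> f"]) (use u True in \<open>auto simp: sum.reindex\<close>)
next
  case False
  then obtain a b where ab: "a \<in> I" "b \<in> I" "a \<noteq> b" "f a = f b"
    by (auto simp: inj_on_def)
  define c where "c = (\<lambda>i. if i = a then 1 else if i = b then - 1 else (0::'a))"
  have "(\<Sum>i\<in>I. c i *s f i) = (\<Sum>i\<in>{a, b}. c i *s f i)"
    by (rule sum.mono_neutral_right) (use assms ab in \<open>auto simp: c_def\<close>)
  also have "\<dots> = 0"
    using ab by (simp add: c_def)
  finally show ?thesis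
    using that[of c] ab(1) by (metis c_def one_neq_zero)
qed

lemma norm_scalar_mult_vec:
  fixes v :: "complex^'p"
  shows "norm (c *s v) = norm c * norm v"
  by (simp add: norm_vec_def norm_mult L2_set_right_distrib)

lemma funpow_matrix_add:
  fixes A :: "'a::comm_ring_1^'p^'p"
  shows "(((*v) A) ^^ n) (v + w) = (((*v) A) ^^ n) v + (((*v) A) ^^ n) w"
  by (induction n) (simp_all add: matrix_vector_right_distrib)

lemma funpow_matrix_scale:
  fixes A :: "'a::field^'p^'p"
  shows "(((*v) A) ^^ n) (c *s v) = c *s (((*v) A) ^^ n) v"
  by (induction n) (simp_all add: vec.scale)

lemma funpow_matrix_diff:
  fixes A :: "'a::comm_ring_1^'p^'p"
  shows "(((*v) A) ^^ n) (v - w) = (((*v) A) ^^ n) v - (((*v) A) ^^ n) w"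
  by (induction n) (simp_all add: matrix_vector_mult_diff_distrib)

lemma funpow_matrix_sum:
  fixes A :: "'a::field^'p^'p"
  shows "(((*v) A) ^^ n) (\<Sum>i\<in>I. f i) = (\<Sum>i\<in>I. (((*v) A) ^^ n) (f i))"
proof (induction n)
  case (Suc n)
  then show ?case by (simp add: vec.sum)
qed simp

text \<open>Growth along a single orbit. Both constants may depend on \<open>v\<close>, so an
  induction can pass from \<open>v\<close> to another vector without tracking them.\<close>

definition poly_growth :: "complex^'p^'p \<Rightarrow> complex^'p \<Rightarrow> bool" where
  "poly_growth A v \<longleftrightarrow>
     (\<exists>C s. \<forall>n. norm ((((*v) A) ^^ n) v) \<le> C * (1 + real n) ^ s)"

text \<open>With \<open>w = A v - z v\<close>, each iteration multiplies the previous iterate by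
  \<open>z\<close>, which does not increase its norm, and adds an iterate of \<open>w\<close>.
  Summing these increments raises the degree of growth by one.\<close>

lemma poly_growth_step:
  fixes A :: "complex^'p^'p"
  assumes "norm z \<le> 1" "poly_growth A (A *v v - z *s v)"
  shows "poly_growth A v"
proof -
  define w where "w = A *v v - z *s v"
  obtain C s where C: "\<And>n. norm ((((*v) A) ^^ n) w) \<le> C * (1 + real n) ^ s"
    using assms(2) unfolding poly_growth_def w_def by blast
  have "0 \<le> C"
    using order.trans[OF norm_ge_zero C[of 0]] by simp
  have "norm ((((*v) A) ^^ n) v) \<le> (norm v + C) * (1 + real n) ^ Suc s" for n
  proof (induction n)
    case 0
    then show ?case using \<open>0 \<le> C\<close> by simp
  next
    case (Suc n)
    have "(((*v) A) ^^ Suc n) v = (((*v) A) ^^ n) (z *s v + w)"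
      by (simp add: w_def funpow_Suc_right del: funpow.simps)
    also have "\<dots> = z *s (((*v) A) ^^ n) v + (((*v) A) ^^ n) w"
      by (simp add: funpow_matrix_add funpow_matrix_scale)
    finally have "norm ((((*v) A) ^^ Suc n) v)
        \<le> norm z * norm ((((*v) A) ^^ n) v) + norm ((((*v) A) ^^ n) w)"
      by (metis norm_triangle_ineq norm_scalar_mult_vec)
    also have "\<dots> \<le> norm ((((*v) A) ^^ n) v) + norm ((((*v) A) ^^ n) w)"
      using assms(1) by (simp add: mult_left_le_one_le)
    also have "\<dots> \<le> (norm v + C) * (1 + real n) ^ Suc s + (norm v + C) * (1 + real n) ^ s"
      by (intro add_mono Suc.IH order.trans[OF C] mult_right_mono) auto
    also have "\<dots> = (norm v + C) * ((2 + real n) * (1 + real n) ^ s)"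
      by (simp add: algebra_simps)
    also have "\<dots> \<le> (norm v + C) * ((2 + real n) * (2 + real n) ^ s)"
      using \<open>0 \<le> C\<close> by (intro mult_left_mono power_mono) auto
    finally show ?case by (simp add: add.commute)
  qed
  then show ?thesis unfolding poly_growth_def by blast
qed

text \<open>The sums are polynomials in \<open>A\<close> applied to a vector, so this is the
  factorization \<open>P(A) v = Q(A) (A - z) v\<close> for \<open>P = (X - z) Q\<close>. The limit
  \<open>n\<close> only bounds the degree, which suits an induction on it.\<close>

lemma sum_coeff_linear_factor:
  fixes A :: "complex^'p^'p"
  assumes "degree Q \<le> n"
  shows "(\<Sum>i\<le>Suc n. coeff ([:-z, 1:] * Q) i *s (((*v) A) ^^ i) v) =
         (\<Sum>i\<le>n. coeff Q i *s (((*v) A) ^^ i) (A *v v - z *s v))"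
proof -
  have Q: "coeff Q (Suc n) = 0"
    using assms by (simp add: coeff_eq_0)
  have "(\<Sum>i\<le>Suc n. coeff ([:-z, 1:] * Q) i *s (((*v) A) ^^ i) v)
      = (\<Sum>i\<le>Suc n. (- z * coeff Q i) *s (((*v) A) ^^ i) v)
        + (\<Sum>i\<le>Suc n. coeff (pCons 0 Q) i *s (((*v) A) ^^ i) v)"
    by (simp only: sum.distrib[symmetric] mult_pCons_left mult_zero_left
        coeff_add coeff_smult vec.scale_left_distrib add_0_right smult_1_left) simp
  also have "(\<Sum>i\<le>Suc n. coeff (pCons 0 Q) i *s (((*v) A) ^^ i) v)
      = (\<Sum>i\<le>n. coeff Q i *s (((*v) A) ^^ i) (A *v v))"
    by (subst sum.atMost_Suc_shift)
       (simp add: funpow_Suc_right del: funpow.simps)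
  also have "(\<Sum>i\<le>Suc n. (- z * coeff Q i) *s (((*v) A) ^^ i) v)
      = (\<Sum>i\<le>n. coeff Q i *s (((*v) A) ^^ i) (- z *s v))"
    by (simp add: Q funpow_matrix_scale mult.commute del: vec.scale_minus_left)
  finally show ?thesis
    by (simp add: sum.distrib[symmetric] vec.scale_right_distrib[symmetric]
        funpow_matrix_add[symmetric])
qed

text \<open>A linear factor whose root \<open>z\<close> is not an eigenvalue is invertible on the orbit and can be
  dropped from the annihilating polynomial; the other factors only cost one degree of growth.\<close>

lemma poly_growth_if_annihilated:
  fixes A :: "complex^'p^'p"
  assumes eig: "\<And>z. is_eigenvalue A z \<Longrightarrow> norm z \<le> 1"
    and "P \<noteq> 0" "degree P \<le> n" "(\<Sum>i\<le>n. coeff P i *s (((*v) A) ^^ i) v) = 0"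
  shows "poly_growth A v"
  using assms(2-)
proof (induction n arbitrary: P v)
  case 0
  then have "coeff P 0 \<noteq> 0"
    by (metis le_zero_eq leading_coeff_0_iff)
  with 0 have "v = 0" by simp
  then have "(((*v) A) ^^ n) v = 0" for n
    by (induction n) auto
  then show ?case
    unfolding poly_growth_def by (metis mult_zero_left norm_zero order_refl)
next
  case (Suc n)
  show ?case
  proof (cases "degree P \<le> n")
    case True
    with Suc show ?thesis by (simp add: coeff_eq_0)
  next
    case False
    then have "\<not> constant (poly P)"
      by (simp add: constant_degree)
    then obtain z where "poly P z = 0"
      using fundamental_theorem_of_algebra by blast
    then obtain Q where Q: "P = [:-z, 1:] * Q"
      by (auto simp: poly_eq_0_iff_dvd)
    have "Q \<noteq> 0"
      using Suc.prems(1) Q by (metis mult_zero_right)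
    then have "degree P = 1 + degree Q"
      unfolding Q by (subst degree_mult_eq) auto
    then have deg: "degree Q \<le> n"
      using Suc.prems(2) by simp
    define w where "w = A *v v - z *s v"
    have w: "(\<Sum>i\<le>n. coeff Q i *s (((*v) A) ^^ i) w) = 0"
      using Suc.prems(3) unfolding Q w_def sum_coeff_linear_factor[OF deg] .
    show ?thesis
    proof (cases "norm z \<le> 1")
      case True
      have "poly_growth A w"
        by (rule Suc.IH[OF \<open>Q \<noteq> 0\<close> deg w])
      then show ?thesis
        using poly_growth_step True w_def by blast
    next
      case False
      \<comment> \<open>Here \<open>u = Q(A) v\<close>, and \<open>(A - z) u = P(A) v = 0\<close>.
        As \<open>z\<close> has modulus above 1 it is no eigenvalue, so \<open>u = 0\<close> and
        \<open>Q\<close> annihilates \<open>v\<close> itself.\<close>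
      define u where "u = (\<Sum>i\<le>n. coeff Q i *s (((*v) A) ^^ i) v)"
      have "(((*v) A) ^^ i) w = A *v (((*v) A) ^^ i) v - z *s (((*v) A) ^^ i) v" for i
        unfolding w_def funpow_matrix_diff funpow_matrix_scale
        by (simp only: funpow_swap1)
      moreover have "A *v u - z *s u =
          (\<Sum>i\<le>n. coeff Q i *s (A *v (((*v) A) ^^ i) v - z *s (((*v) A) ^^ i) v))"
        unfolding u_def vec.sum vec.scale vec.scale_sum_right sum_subtractf[symmetric]
          vec.scale_right_diff_distrib vec.scale_scale
        by (simp only: mult.commute)
      ultimately have "A *v u - z *s u = 0"
        using w by simp
      then have "u = 0"
        using eig[of z] False unfolding is_eigenvalue_def by auto
      then show ?thesis
        by (intro Suc.IH[OF \<open>Q \<noteq> 0\<close> deg]) (simp only: u_def)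
    qed
  qed
qed

text \<open>The \<open>p + 1\<close> vectors \<open>v, A v, ..., A^p v\<close> are linearly
  dependent, and the coefficients of a relation form a nonzero polynomial annihilating
  \<open>v\<close>.\<close>

lemma poly_growth_vector:
  fixes A :: "complex^'p^'p"
  assumes "\<And>z. is_eigenvalue A z \<Longrightarrow> norm z \<le> 1"
  shows "poly_growth A v"
proof -
  obtain c where c: "\<exists>i\<in>{..CARD('p)}. c i \<noteq> 0"
      "(\<Sum>i\<in>{..CARD('p)}. c i *s (((*v) A) ^^ i) v) = 0"
    by (rule linear_relation_exists[of "{..CARD('p)}" "\<lambda>i. (((*v) A) ^^ i) v"]) auto
  define P where "P = (\<Sum>i\<le>CARD('p). monom (c i) i)"
  have coeff: "coeff P i = (if i \<le> CARD('p) then c i else 0)" for i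
    by (simp add: P_def coeff_sum)
  show ?thesis
  proof (rule poly_growth_if_annihilated[OF assms])
    show "P \<noteq> 0" using c(1) coeff by (auto simp: poly_eq_iff)
    show "degree P \<le> CARD('p)" by (rule degree_le) (simp add: coeff)
    show "(\<Sum>i\<le>CARD('p). coeff P i *s (((*v) A) ^^ i) v) = 0"
      using c(2) by (simp add: coeff)
  qed
qed

lemma funpow_matrix_poly_bound:
  fixes A :: "complex^'p^'p"
  assumes "\<And>z. is_eigenvalue A z \<Longrightarrow> norm z \<le> 1"
  obtains C s where "0 \<le> C" "\<And>n v. norm ((((*v) A) ^^ n) v) \<le> C * (1 + real n) ^ s * norm v"
proof -
  have "\<forall>i. \<exists>C s. \<forall>n. norm ((((*v) A) ^^ n) (axis i 1)) \<le> C * (1 + real n) ^ s"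
    using poly_growth_vector[OF assms] unfolding poly_growth_def by blast
  then obtain C s where C: "\<And>i n. norm ((((*v) A) ^^ n) (axis i 1)) \<le> C i * (1 + real n) ^ s i"
    by metis
  have C0: "0 \<le> C i" for i
    using order.trans[OF norm_ge_zero C[of 0 i]] by simp
  \<comment> \<open>The sum of the exponents serves as a common upper bound for them, so that one
    power covers all basis vectors.\<close>
  define S where "S = (\<Sum>i\<in>UNIV. s i)"
  have s: "s i \<le> S" for i
    unfolding S_def by (rule member_le_sum) auto
  show ?thesis
  proof (rule that[of "\<Sum>i\<in>UNIV. C i" S])
    show "0 \<le> (\<Sum>i\<in>UNIV. C i)" by (simp add: C0 sum_nonneg)
    fix n and v :: "complex^'p"
    have "(((*v) A) ^^ n) v = (((*v) A) ^^ n) (\<Sum>i\<in>UNIV. v $ i *s axis i 1)"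
      by (simp add: basis_expansion)
    also have "\<dots> = (\<Sum>i\<in>UNIV. v $ i *s (((*v) A) ^^ n) (axis i 1))"
      by (simp add: funpow_matrix_sum funpow_matrix_scale)
    also have "norm \<dots> \<le> (\<Sum>i\<in>UNIV. norm v * (C i * (1 + real n) ^ S))"
    proof (intro sum_norm_le)
      fix i
      have "norm (v $ i *s (((*v) A) ^^ n) (axis i 1)) \<le> norm v * (C i * (1 + real n) ^ s i)"
        unfolding norm_scalar_mult_vec by (intro mult_mono Finite_Cartesian_Product.norm_nth_le C) auto
      also have "\<dots> \<le> norm v * (C i * (1 + real n) ^ S)"
        using s C0 by (intro mult_left_mono power_increasing) auto
      finally show "norm (v $ i *s (((*v) A) ^^ n) (axis i 1)) \<le> norm v * (C i * (1 + real n) ^ S)" .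
    qed
    also have "\<dots> = (\<Sum>i\<in>UNIV. C i) * (1 + real n) ^ S * norm v"
      by (simp add: sum_distrib_left sum_distrib_right mult_ac)
    finally show "norm ((((*v) A) ^^ n) v) \<le> (\<Sum>i\<in>UNIV. C i) * (1 + real n) ^ S * norm v" .
  qed
qed

text \<open>Transfers the condition on the eigenvalues of \<open>\<rho> T_mat\<close> to its
  inverse, so that translations in both directions have polynomially bounded cost.\<close>

lemma is_eigenvalue_matrix_inv:
  fixes A :: "complex^'p^'p"
  assumes "invertible A" "is_eigenvalue (matrix_inv A) z"
  shows "z \<noteq> 0 \<and> is_eigenvalue A (inverse z)"
proof -
  obtain v where v: "v \<noteq> 0" "matrix_inv A *v v = z *s v"
    using assms(2) unfolding is_eigenvalue_def by blast
  have "v = A *v (matrix_inv A *v v)"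
    using someI_ex[OF assms(1)[unfolded invertible_def]]
    by (simp add: matrix_inv_def matrix_vector_mul_assoc)
  then have *: "v = z *s (A *v v)"
    using v(2) by (simp add: vec.scale)
  then have "z \<noteq> 0" using v(1) by auto
  then have "A *v v = inverse z *s v"
    using * by (metis left_inverse vector_smult_assoc vector_smult_lid)
  with \<open>z \<noteq> 0\<close> v(1) show ?thesis unfolding is_eigenvalue_def by blast
qed

section \<open>Reduction to the fundamental domain\<close>

definition S_mat :: "int^2^2" where
  "S_mat = vector [vector [0, -1], vector [1, 0]]"

lemma T_mat_in_SL2Z: "T_mat \<in> SL2Z"
  by (simp add: SL2Z_def T_mat_def det_2)

lemma S_mat_in_SL2Z: "S_mat \<in> SL2Z"
  by (simp add: SL2Z_def S_mat_def det_2)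

section \<open>Norm bounds for translation and inversion\<close>

lemma vvmf_T:
  assumes "vvmf k \<rho> F" "0 < Im \<tau>"
  shows "F (\<tau> + 1) = \<rho> T_mat *v F \<tau>"
proof -
  have "\<rho> T_mat *v F \<tau> = slash k F T_mat \<tau>"
    using assms T_mat_in_SL2Z by (simp add: vvmf_def upper_half_plane_def)
  then show ?thesis
    by (simp add: slash_def moebius_def T_mat_def)
qed

lemma vvmf_S:
  assumes "vvmf k \<rho> F" "0 < Im \<tau>"
  shows "\<rho> S_mat *v F \<tau> = (\<tau> powr (- of_real k)) *s F (- 1 / \<tau>)"
proof -
  have "\<rho> S_mat *v F \<tau> = slash k F S_mat \<tau>"
    using assms S_mat_in_SL2Z by (simp add: vvmf_def upper_half_plane_def)
  then show ?thesis
    by (simp add: slash_def moebius_def S_mat_def)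
qed

lemma vvmf_translate:
  assumes "vvmf k \<rho> F" "0 < Im \<tau>"
  shows "F (\<tau> + of_nat n) = (((*v) (\<rho> T_mat)) ^^ n) (F \<tau>)"
proof (induction n)
  case (Suc n)
  have "F (\<tau> + of_nat (Suc n)) = F ((\<tau> + of_nat n) + 1)"
    by (simp add: algebra_simps)
  also have "\<dots> = \<rho> T_mat *v F (\<tau> + of_nat n)"
    using assms by (intro vvmf_T) auto
  finally show ?case by (simp add: Suc)
qed simp

lemma matrix_inv_mult_left:
  fixes A :: "complex^'p^'p"
  assumes "invertible A"
  shows "matrix_inv A *v (A *v v) = v"
  using someI_ex[OF assms[unfolded invertible_def]]
  by (simp add: matrix_inv_def matrix_vector_mul_assoc)

lemma funpow_matrix_inv:
  fixes A :: "complex^'p^'p"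
  assumes "invertible A"
  shows "(((*v) (matrix_inv A)) ^^ n) ((((*v) A) ^^ n) v) = v"
proof (induction n)
  case (Suc n)
  have "(((*v) (matrix_inv A)) ^^ Suc n) ((((*v) A) ^^ Suc n) v) =
      (((*v) (matrix_inv A)) ^^ n) (matrix_inv A *v (A *v ((((*v) A) ^^ n) v)))"
    by (subst funpow_Suc_right) simp
  then show ?case by (simp only: matrix_inv_mult_left[OF assms] Suc)
qed simp

text \<open>\<open>F w\<close> is recovered from \<open>F (w + n)\<close> by applying a power of
  \<open>\<rho> T_mat\<close> if \<open>n\<close> is negative and of its inverse otherwise. The
  constants are fixed before \<open>k\<close> and \<open>F\<close>, hence depend on
  \<open>\<rho>\<close> alone.\<close>

lemma vvmf_translation_bound:
  fixes \<rho> :: "int^2^2 \<Rightarrow> complex^'p^'p"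
  assumes rep: "SL2Z_representation \<rho>"
    and eig: "\<And>z. is_eigenvalue (\<rho> T_mat) z \<Longrightarrow> norm z = 1"
  obtains C s where "0 \<le> C"
    "\<And>k F w n. vvmf k \<rho> F \<Longrightarrow> 0 < Im w \<Longrightarrow>
       norm (F w) \<le> C * (1 + \<bar>of_int n\<bar>) ^ s * norm (F (w + of_int n))"
proof -
  define A where "A = \<rho> T_mat"
  have inv: "invertible A"
    using rep T_mat_in_SL2Z by (simp add: SL2Z_representation_def A_def)
  have "\<And>z. is_eigenvalue A z \<Longrightarrow> norm z \<le> 1"
    using eig A_def by fastforce
  then obtain C1 s1 where C1: "0 \<le> C1"
      "\<And>n v. norm ((((*v) A) ^^ n) v) \<le> C1 * (1 + real n) ^ s1 * norm v"
    using funpow_matrix_poly_bound by blast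
  have "norm z \<le> 1" if "is_eigenvalue (matrix_inv A) z" for z
  proof -
    have "norm (inverse z) = 1"
      using eig is_eigenvalue_matrix_inv[OF inv that] unfolding A_def by blast
    then show ?thesis
      by (simp add: norm_inverse)
  qed
  then obtain C2 s2 where C2: "0 \<le> C2"
      "\<And>n v. norm ((((*v) (matrix_inv A)) ^^ n) v) \<le> C2 * (1 + real n) ^ s2 * norm v"
    using funpow_matrix_poly_bound by blast
  show ?thesis
  proof (rule that[of "C1 + C2" "s1 + s2"])
    show "0 \<le> C1 + C2" using C1 C2 by simp
    fix k F w and n :: int
    assume F: "vvmf k \<rho> F" and w: "0 < Im w"
    define m where "m = nat \<bar>n\<bar>"
    have m: "\<bar>of_int n\<bar> = real m" by (simp add: m_def)
    have mono: "C * (1 + real m) ^ s * norm (F (w + of_int n))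
        \<le> (C1 + C2) * (1 + \<bar>of_int n\<bar>) ^ (s1 + s2) * norm (F (w + of_int n))"
      if "0 \<le> C" "C \<le> C1 + C2" "s \<le> s1 + s2" for C s
      unfolding m using that by (intro mult_right_mono mult_mono power_increasing) auto
    show "norm (F w) \<le> (C1 + C2) * (1 + \<bar>of_int n\<bar>) ^ (s1 + s2) * norm (F (w + of_int n))"
    proof (cases "0 \<le> n")
      case True
      then have n: "of_int n = (of_nat m :: complex)" by (simp add: m_def)
      have "F (w + of_int n) = (((*v) A) ^^ m) (F w)"
        unfolding n A_def by (rule vvmf_translate[OF F w])
      then have "F w = (((*v) (matrix_inv A)) ^^ m) (F (w + of_int n))"
        by (simp only: funpow_matrix_inv[OF inv])
      then have "norm (F w) \<le> C2 * (1 + real m) ^ s2 * norm (F (w + of_int n))"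
        by (metis C2(2))
      also note mono[of C2 s2]
      finally show ?thesis using C1 C2 by simp
    next
      case False
      then have n: "of_int n = - (of_nat m :: complex)" by (simp add: m_def)
      have "F w = F ((w + of_int n) + of_nat m)" by (simp add: n)
      also have "\<dots> = (((*v) A) ^^ m) (F (w + of_int n))"
        unfolding A_def by (rule vvmf_translate[OF F]) (use w in simp)
      finally have "norm (F w) \<le> C1 * (1 + real m) ^ s1 * norm (F (w + of_int n))"
        by (metis C1(2))
      also note mono[of C1 s1]
      finally show ?thesis using C1 C2 by simp
    qed
  qed
qed

text \<open>\<open>D\<close> bounds the inverse of \<open>\<rho> S_mat\<close> as a linear map. The
  weight enters only through the automorphy factor, whose norm is a real power of
  \<open>norm w\<close> because \<open>k\<close> is real.\<close>

lemma vvmf_inversion_bound: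
  fixes \<rho> :: "int^2^2 \<Rightarrow> complex^'p^'p"
  assumes rep: "SL2Z_representation \<rho>"
  obtains D where "0 \<le> D"
    "\<And>k F w. vvmf k \<rho> F \<Longrightarrow> 0 < Im w \<Longrightarrow>
       norm (F w) \<le> D * norm w powr (- k) * norm (F (- 1 / w))"
proof -
  define B where "B = matrix_inv (\<rho> S_mat)"
  have inv: "invertible (\<rho> S_mat)"
    using rep S_mat_in_SL2Z by (simp add: SL2Z_representation_def)
  have "bounded_linear ((*v) B)"
    by (rule matrix_vector_mul_bounded_linear)
  then obtain D where D: "0 \<le> D" "\<And>v. norm (B *v v) \<le> norm v * D"
    using bounded_linear.nonneg_bounded by blast
  show ?thesis
  proof (rule that[OF D(1)])
    fix k F w
    assume F: "vvmf k \<rho> F" and w: "0 < Im w"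
    have "F w = B *v (\<rho> S_mat *v F w)"
      by (simp add: B_def matrix_inv_mult_left[OF inv])
    then have "norm (F w) \<le> norm (\<rho> S_mat *v F w) * D"
      using D(2)[of "\<rho> S_mat *v F w"] by simp
    also have "norm (\<rho> S_mat *v F w) = norm w powr (- k) * norm (F (- 1 / w))"
      by (simp add: vvmf_S[OF F w] norm_scalar_mult_vec norm_powr_real_powr')
    finally show "norm (F w) \<le> D * norm w powr (- k) * norm (F (- 1 / w))"
      by (simp add: mult_ac)
  qed
qed

text \<open>Each step \<open>\<tau> \<mapsto> -1/\<tau> + n\<close> of the reduction multiplies \<open>Im \<tau>\<close> by \<open>R = 1/\<bar>\<tau>\<bar>\<^sup>2 \<ge> 2\<close>, and its
  cost is at most \<open>R\<^sup>\<beta>\<close> because \<open>n\<close> is bounded in terms of \<open>R\<close>; so the costs telescope.\<close>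

lemma vvmf_reduction_bound:
  fixes \<rho> :: "int^2^2 \<Rightarrow> complex^'p^'p"
  assumes rep: "SL2Z_representation \<rho>"
    and eig: "\<And>z. is_eigenvalue (\<rho> T_mat) z \<Longrightarrow> norm z = 1"
  obtains \<beta> where "0 \<le> \<beta>"
    "\<And>k F \<tau>. vvmf k \<rho> F \<Longrightarrow> \<bar>Re \<tau>\<bar> \<le> 1/2 \<Longrightarrow> 0 < Im \<tau> \<Longrightarrow>
       \<exists>z c d. \<bar>Re z\<bar> \<le> 1/2 \<and> 1/2 \<le> Im z \<and> (c, d) \<noteq> (0, 0) \<and>
         Im z * (norm (of_int c * \<tau> + of_int d))\<^sup>2 = Im \<tau> \<and>
         norm (F \<tau>) \<le> (Im z / Im \<tau>) powr (\<beta> + k/2) * norm (F z)"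
proof -
  obtain C s where C: "0 \<le> C"
    "\<And>k F w n. vvmf k \<rho> F \<Longrightarrow> 0 < Im w \<Longrightarrow>
       norm (F w) \<le> C * (1 + \<bar>of_int n\<bar>) ^ s * norm (F (w + of_int n))"
    using vvmf_translation_bound[OF rep eig] by metis
  obtain D where D: "0 \<le> D"
    "\<And>k F w. vvmf k \<rho> F \<Longrightarrow> 0 < Im w \<Longrightarrow>
       norm (F w) \<le> D * norm w powr (- k) * norm (F (- 1 / w))"
    using vvmf_inversion_bound[OF rep] by metis
  \<comment> \<open>Every step has \<open>R \<ge> 2\<close>, so \<open>R ^ b\<close> absorbs the
    constant \<open>D * C\<close>. The remaining factor, a power of \<open>1 + |n|\<close>, costs at
    most \<open>R ^ (2 * s)\<close>, whence the exponent \<open>b + 2 * s\<close>.\<close>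
  obtain b where b: "D * C < 2 ^ b"
    using real_arch_pow[of 2 "D * C"] by auto
  define \<beta> where "\<beta> = real (b + 2 * s)"
  have step: "D * C * (1 + \<bar>of_int n\<bar>) ^ s \<le> (r\<^sup>2) powr \<beta>"
    if r: "2 \<le> r\<^sup>2" "0 \<le> r" "\<bar>of_int n\<bar> \<le> r + 1/2" for r :: real and n :: int
  proof -
    have "0 \<le> (r - 1)\<^sup>2" by simp
    then have "2 * r \<le> r\<^sup>2 + 1" by (simp add: power2_eq_square algebra_simps)
    then have "1 + \<bar>of_int n\<bar> \<le> 2 * r\<^sup>2" using r by linarith
    also have "\<dots> \<le> r\<^sup>2 * r\<^sup>2" using r by (intro mult_right_mono) auto
    finally have "(1 + \<bar>real_of_int n\<bar>) ^ s \<le> ((r\<^sup>2)\<^sup>2) ^ s"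
      by (intro power_mono) (auto simp: power2_eq_square)
    moreover have "D * C \<le> (r\<^sup>2) ^ b"
      using b power_mono[OF r(1), of b] by simp
    ultimately have "D * C * (1 + \<bar>of_int n\<bar>) ^ s \<le> (r\<^sup>2) ^ b * ((r\<^sup>2)\<^sup>2) ^ s"
      using C D by (intro mult_mono) auto
    also have "\<dots> = (r\<^sup>2) ^ (b + 2 * s)" by (simp add: power_add power_mult)
    also have "\<dots> = (r\<^sup>2) powr \<beta>"
      unfolding \<beta>_def using r by (subst powr_realpow) auto
    finally show ?thesis .
  qed
  \<comment> \<open>Induction on a bound \<open>N\<close> for the number of steps: each step at
    least doubles the imaginary part. The pair \<open>(c, d)\<close> plays the role of the bottom
    row of the matrix moving \<open>\<tau>\<close> to \<open>z\<close>, and starts as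
    \<open>(0, 1)\<close>.\<close>
  have reduce: "\<exists>z c d. \<bar>Re z\<bar> \<le> 1/2 \<and> 1/2 \<le> Im z \<and> (c, d) \<noteq> (0, 0) \<and>
         Im z * (norm (of_int c * \<tau> + of_int d))\<^sup>2 = Im \<tau> \<and>
         norm (F \<tau>) \<le> (Im z / Im \<tau>) powr (\<beta> + k/2) * norm (F z)"
    if F: "vvmf k \<rho> F" and "\<bar>Re \<tau>\<bar> \<le> 1/2" "0 < Im \<tau>" "1/2 \<le> 2 ^ N * Im \<tau>" for k F \<tau> N
    using that(2-)
  proof (induction N arbitrary: \<tau>)
    case 0
    then show ?case
      by (intro exI[of _ \<tau>] exI[of _ 0] exI[of _ 1]) auto
  next
    case (Suc N)
    show ?case
    proof (cases "1/2 \<le> Im \<tau>")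
      case True
      with Suc.prems show ?thesis
        by (intro exI[of _ \<tau>] exI[of _ 0] exI[of _ 1]) auto
    next
      case False
      have \<tau>0: "\<tau> \<noteq> 0" using Suc.prems by auto
      define r where "r = norm (- 1 / \<tau>)"
      have r0: "0 < r" using \<tau>0 by (simp add: r_def)
      have rn: "r\<^sup>2 = 1 / (norm \<tau>)\<^sup>2"
        by (simp add: r_def norm_divide power_divide)
      have "(Re \<tau>)\<^sup>2 \<le> (1/2)\<^sup>2" "(Im \<tau>)\<^sup>2 \<le> (1/2)\<^sup>2"
        using Suc.prems False by (auto simp: abs_le_square_iff[symmetric])
      then have "(norm \<tau>)\<^sup>2 \<le> 1/2"
        unfolding cmod_power2 by (simp add: power2_eq_square)
      then have r2: "2 \<le> r\<^sup>2"
        using \<tau>0 unfolding rn by (simp add: field_simps)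
      \<comment> \<open>Rounding brings the real part back into the strip and keeps
        \<open>|n|\<close> within 1/2 of the real part of \<open>-1/\<tau>\<close>, hence at most
        \<open>r + 1/2\<close>.\<close>
      define n where "n = - round (Re (- 1 / \<tau>))"
      define t where "t = - 1 / \<tau> + of_int n"
      have "Re t = Re (- 1 / \<tau>) - of_int (round (Re (- 1 / \<tau>)))"
        by (simp add: t_def n_def)
      then have Re_t: "\<bar>Re t\<bar> \<le> 1/2"
        using of_int_round_abs_le[of "Re (- 1 / \<tau>)"] by linarith
      have "\<bar>of_int n\<bar> \<le> \<bar>Re (- 1 / \<tau>)\<bar> + \<bar>Re t\<bar>"
        unfolding t_def by (simp del: minus_divide_left[symmetric])
      then have n: "\<bar>of_int n\<bar> \<le> r + 1/2"
        using Re_t abs_Re_le_cmod[of "- 1 / \<tau>"] unfolding r_def by linarith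
      have Im1: "Im (- 1 / \<tau>) = Im \<tau> * r\<^sup>2"
        unfolding rn cmod_power2 by (simp add: Im_divide)
      then have Im1_pos: "0 < Im (- 1 / \<tau>)"
        using Suc.prems(2) r0 by (simp only: mult_pos_pos zero_less_power)
      from Im1 have Im_t: "Im t = Im \<tau> * r\<^sup>2"
        by (simp add: t_def)
      have Im_t0: "0 < Im t" using Im_t Suc.prems r0 by simp
      have "2 ^ N * (Im \<tau> * 2) \<le> 2 ^ N * (Im \<tau> * r\<^sup>2)"
        using Suc.prems r2 by (intro mult_left_mono) auto
      moreover have "1/2 \<le> 2 ^ N * (Im \<tau> * 2)"
        using Suc.prems by simp
      ultimately have tN: "1/2 \<le> 2 ^ N * Im t"
        unfolding Im_t by (rule order.trans[rotated])
      obtain z c d where z: "\<bar>Re z\<bar> \<le> 1/2" "1/2 \<le> Im z" "(c, d) \<noteq> (0, 0)"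
         "Im z * (norm (of_int c * t + of_int d))\<^sup>2 = Im t"
         "norm (F t) \<le> (Im z / Im t) powr (\<beta> + k/2) * norm (F z)"
        using Suc.IH[OF Re_t Im_t0 tN] by (elim exE conjE)
      \<comment> \<open>Composing with the step turns the row \<open>(c, d)\<close> for
        \<open>t\<close> into \<open>(c * n + d, - c)\<close> for \<open>\<tau>\<close>.\<close>
      have "of_int c * t + of_int d = (of_int (c * n + d) * \<tau> + of_int (- c)) / \<tau>"
        using \<tau>0 by (simp add: t_def field_simps)
      then have "(norm (of_int c * t + of_int d))\<^sup>2
          = (norm (of_int (c * n + d) * \<tau> + of_int (- c)))\<^sup>2 * r\<^sup>2"
        unfolding rn by (simp add: norm_divide power_divide)
      then have "Im z * (norm (of_int (c * n + d) * \<tau> + of_int (- c)))\<^sup>2 = Im \<tau>"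
        using z(4) r0 unfolding Im_t by simp
      moreover have "(c * n + d, - c) \<noteq> (0, 0)" using z(3) by auto
      moreover have "norm (F \<tau>) \<le> (Im z / Im \<tau>) powr (\<beta> + k/2) * norm (F z)"
      proof -
        have "norm \<tau> powr (- k) = (r\<^sup>2) powr (k/2)"
        proof -
          have "(r\<^sup>2) powr (k/2) = r powr k"
            unfolding powr_numeral[OF less_imp_le[OF r0], symmetric] powr_powr by simp
          also have "\<dots> = norm \<tau> powr (- k)"
            unfolding r_def by (simp add: norm_divide powr_divide powr_minus_divide)
          finally show ?thesis by simp
        qed
        then have "norm (F \<tau>) \<le> D * (r\<^sup>2) powr (k/2) * norm (F (- 1 / \<tau>))"
          using D(2)[OF F, of \<tau>] Suc.prems by simp
        also have "\<dots> \<le> D * (r\<^sup>2) powr (k/2) * (C * (1 + \<bar>of_int n\<bar>) ^ s * norm (F t))"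
          using C(2)[OF F Im1_pos, of n, folded t_def] D(1) by (intro mult_left_mono) auto
        also have "\<dots> = (D * C * (1 + \<bar>of_int n\<bar>) ^ s) * (r\<^sup>2) powr (k/2) * norm (F t)"
          by (simp add: mult_ac)
        also have "\<dots> \<le> (r\<^sup>2) powr \<beta> * (r\<^sup>2) powr (k/2) * norm (F t)"
          using step[OF r2 _ n] r0 by (intro mult_right_mono) auto
        also have "\<dots> = (r\<^sup>2) powr (\<beta> + k/2) * norm (F t)"
          by (simp add: powr_add)
        also have "\<dots> \<le> (r\<^sup>2) powr (\<beta> + k/2) * ((Im z / Im t) powr (\<beta> + k/2) * norm (F z))"
          by (intro mult_left_mono z) auto
        also have "\<dots> = (r\<^sup>2 * (Im z / Im t)) powr (\<beta> + k/2) * norm (F z)"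
          by (subst powr_mult) (use z(2) Im_t0 in auto)
        also have "r\<^sup>2 * (Im z / Im t) = Im z / Im \<tau>"
          using r0 unfolding Im_t by simp
        finally show ?thesis .
      qed
      ultimately show ?thesis using z(1,2) by blast
    qed
  qed
  show ?thesis
  proof (rule that)
    show "0 \<le> \<beta>" by (simp add: \<beta>_def)
    fix k F \<tau> assume *: "vvmf k \<rho> F" "\<bar>Re \<tau>\<bar> \<le> 1/2" "0 < Im \<tau>"
    obtain N where "1 / (2 * Im \<tau>) < 2 ^ N"
      using real_arch_pow[of 2 "1 / (2 * Im \<tau>)"] by auto
    then have "1/2 \<le> 2 ^ N * Im \<tau>" using *(3) by (simp add: field_simps)
    then show "\<exists>z c d. \<bar>Re z\<bar> \<le> 1/2 \<and> 1/2 \<le> Im z \<and> (c, d) \<noteq> (0, 0) \<and>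
         Im z * (norm (of_int c * \<tau> + of_int d))\<^sup>2 = Im \<tau> \<and>
         norm (F \<tau>) \<le> (Im z / Im \<tau>) powr (\<beta> + k/2) * norm (F z)"
      by (rule reduce[OF *])
  qed
qed

section \<open>Growth at the cusp\<close>

lemma norm_gbinomial_le:
  fixes z :: complex
  shows "norm (z gchoose t) \<le> (norm z + real t) ^ t"
proof -
  have "norm (z gchoose t) = (\<Prod>i = 0..<t. norm (z - of_nat i)) / fact t"
    by (simp add: gbinomial_prod_rev norm_divide prod_norm)
  also have "\<dots> \<le> (\<Prod>i = 0..<t. norm (z - of_nat i)) / 1"
    by (intro divide_left_mono prod_nonneg) auto
  also have "\<dots> \<le> (\<Prod>i = 0..<t. norm z + real t) / 1"
  proof (intro divide_right_mono prod_mono conjI)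
    fix i assume "i \<in> {0..<t}"
    then show "norm (z - of_nat i) \<le> norm z + real t"
      using norm_triangle_ineq4[of z "of_nat i"] by simp
  qed auto
  finally show ?thesis by simp
qed

lemma norm_q_term:
  "norm (a * exp (2 * of_real pi * \<i> * of_real m * \<tau>)) = norm a * exp (- 2 * pi * m * Im \<tau>)"
  by (simp add: norm_mult norm_exp_eq_Re)

text \<open>Unconditional summability of complex families is absolute, and the norm of a term
  depends only on the height, so the point \<open>Complex 0 y\<close> decides the whole horizontal
  line.\<close>

lemma q_series_summable:
  assumes "q_series_sums \<mu> a h" "0 < y"
  shows "(\<lambda>n. norm (a n) * exp (- 2 * pi * (of_int n + \<mu>) * y)) summable_on UNIV"
proof -
  have "(\<lambda>n. a n * exp (2 * of_real pi * \<i> * of_real (of_int n + \<mu>) * Complex 0 y)) summable_on UNIV"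
    using assms unfolding q_series_sums_def upper_half_plane_def
    by (intro has_sum_imp_summable[of _ _ "h (Complex 0 y)"]) auto
  then show ?thesis
    unfolding summable_on_iff_abs_summable_on_complex norm_q_term by simp
qed

lemma q_series_sums_at:
  assumes "q_series_sums \<mu> a h" "0 < Im \<tau>"
  shows "((\<lambda>n. a n * exp (2 * of_real pi * \<i> * of_real (of_int n + \<mu>) * \<tau>)) has_sum h \<tau>) UNIV"
  using assms unfolding q_series_sums_def upper_half_plane_def by blast

text \<open>The absolute series at height \<open>Im z\<close> is compared termwise with the one at
  height 1/2; every exponent that occurs is at least \<open>\<delta>\<close>, which yields the
  factor. \<open>\<delta> = 0\<close> gives boundedness, \<open>\<delta> > 0\<close> exponential
  decay.\<close>

lemma q_series_exp_bound:
  assumes q: "q_series_sums \<mu> a h" and \<delta>: "\<And>n. a n \<noteq> 0 \<Longrightarrow> \<delta> \<le> of_int n + \<mu>"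
  obtains K where "0 \<le> K" "\<And>z. 1/2 \<le> Im z \<Longrightarrow> norm (h z) \<le> K * exp (- 2 * pi * \<delta> * (Im z - 1/2))"
proof -
  define f where "f = (\<lambda>n. norm (a n) * exp (- 2 * pi * (of_int n + \<mu>) * (1/2)))"
  have f: "f summable_on UNIV"
    unfolding f_def by (rule q_series_summable[OF q]) simp
  show ?thesis
  proof (rule that[of "infsum f UNIV"])
    show "0 \<le> infsum f UNIV" by (rule infsum_nonneg) (simp add: f_def)
    fix z :: complex assume z: "1/2 \<le> Im z"
    then have z0: "0 < Im z" by simp
    have sumz: "(\<lambda>n. norm (a n) * exp (- 2 * pi * (of_int n + \<mu>) * Im z)) summable_on UNIV"
      by (rule q_series_summable[OF q z0])
    have "norm (h z) \<le> infsum (\<lambda>n. norm (a n) * exp (- 2 * pi * (of_int n + \<mu>) * Im z)) UNIV"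
      by (rule norm_has_sum_bound[OF _ q_series_sums_at[OF q z0]])
         (unfold norm_q_term, rule has_sum_infsum[OF sumz])
    also have "\<dots> \<le> infsum (\<lambda>n. f n * exp (- 2 * pi * \<delta> * (Im z - 1/2))) UNIV"
    proof (rule infsum_mono[OF sumz summable_on_cmult_left[OF f]])
      fix n
      show "norm (a n) * exp (- 2 * pi * (of_int n + \<mu>) * Im z) \<le> f n * exp (- 2 * pi * \<delta> * (Im z - 1/2))"
      proof (cases "a n = 0")
        case False
        have "2 * pi * (\<delta> * (Im z - 1/2)) \<le> 2 * pi * ((of_int n + \<mu>) * (Im z - 1/2))"
          using \<delta>[OF False] z by (intro mult_left_mono mult_right_mono) auto
        then have "exp (- 2 * pi * (of_int n + \<mu>) * Im z)
            \<le> exp (- 2 * pi * (of_int n + \<mu>) * (1/2) + - 2 * pi * \<delta> * (Im z - 1/2))"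
          by (simp add: algebra_simps add_divide_distrib)
        then show ?thesis
          unfolding f_def mult.assoc[of "norm (a n)"] exp_add[symmetric]
          by (intro mult_left_mono) auto
      qed (simp add: f_def)
    qed
    also have "\<dots> = infsum f UNIV * exp (- 2 * pi * \<delta> * (Im z - 1/2))"
      by (rule infsum_cmult_left) (rule f)
    finally show "norm (h z) \<le> infsum f UNIV * exp (- 2 * pi * \<delta> * (Im z - 1/2))" .
  qed
qed

lemma exp_minus_le_inverse_power:
  fixes b :: real
  assumes "0 < b"
  obtains K where "0 \<le> K" "\<And>y. 0 < y \<Longrightarrow> exp (- b * y) \<le> K * (1 / y) ^ N"
proof (rule that[of "(real (Suc N) / b) ^ N"])
  show "0 \<le> (real (Suc N) / b) ^ N" using assms by simp
  fix y :: real assume y: "0 < y"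
  \<comment> \<open>The estimate is \<open>x \<le> exp x\<close> raised to the power
    \<open>N\<close>. Dividing by \<open>Suc N\<close> rather than \<open>N\<close> keeps
    \<open>x\<close> meaningful for \<open>N = 0\<close>.\<close>
  define x where "x = b * y / real (Suc N)"
  have x: "0 < x" using assms y by (simp add: x_def)
  have "x ^ N \<le> exp x ^ N"
    using x exp_ge_add_one_self[of x] by (intro power_mono) linarith+
  also have "\<dots> = exp (real N * x)" by (simp add: exp_of_nat_mult)
  also have "\<dots> \<le> exp (b * y)"
    using assms y by (simp add: x_def divide_simps)
  finally have "exp (- b * y) \<le> (1 / x) ^ N"
    using x by (simp add: exp_minus field_simps)
  also have "1 / x = (real (Suc N) / b) * (1 / y)" by (simp add: x_def)
  finally show "exp (- b * y) \<le> (real (Suc N) / b) ^ N * (1 / y) ^ N"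
    by (simp only: power_mult_distrib)
qed

lemma q_series_cuspidal_bound:
  assumes q: "q_series_sums \<mu> a h" and cusp: "\<And>n. of_int n + \<mu> \<le> 0 \<Longrightarrow> a n = 0"
  obtains K where "0 \<le> K" "\<And>z. 1/2 \<le> Im z \<Longrightarrow> norm (h z) \<le> K * (1 / Im z) ^ N"
proof -
  \<comment> \<open>The least positive value of \<open>n + \<mu>\<close> over the integers:
    cuspidality leaves a gap above 0, and the resulting exponential decay beats every power.\<close>
  define \<delta> where "\<delta> = of_int (\<lfloor>- \<mu>\<rfloor> + 1) + \<mu>"
  have \<delta>: "0 < \<delta>" unfolding \<delta>_def by linarith
  have "\<delta> \<le> of_int n + \<mu>" if "a n \<noteq> 0" for n
  proof -
    have "0 < of_int n + \<mu>" using cusp that by force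
    then have "\<lfloor>- \<mu>\<rfloor> + 1 \<le> n" by linarith
    then show ?thesis unfolding \<delta>_def by simp
  qed
  then obtain K where K: "0 \<le> K"
      "\<And>z. 1/2 \<le> Im z \<Longrightarrow> norm (h z) \<le> K * exp (- 2 * pi * \<delta> * (Im z - 1/2))"
    using q_series_exp_bound[OF q] by blast
  obtain L where L: "0 \<le> L" "\<And>y. 0 < y \<Longrightarrow> exp (- (2 * pi * \<delta>) * y) \<le> L * (1 / y) ^ N"
    using exp_minus_le_inverse_power[of "2 * pi * \<delta>" N] \<delta> by auto
  show ?thesis
  proof (rule that[of "K * exp (pi * \<delta>) * L"])
    show "0 \<le> K * exp (pi * \<delta>) * L" using K L by simp
    fix z assume z: "1/2 \<le> Im z"
    have "norm (h z) \<le> K * exp (- 2 * pi * \<delta> * (Im z - 1/2))" by (rule K(2)[OF z])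
    also have "\<dots> = K * exp (pi * \<delta>) * exp (- (2 * pi * \<delta>) * Im z)"
      by (simp add: exp_add[symmetric] algebra_simps)
    also have "\<dots> \<le> K * exp (pi * \<delta>) * (L * (1 / Im z) ^ N)"
      using z K(1) by (intro mult_left_mono L) auto
    finally show "norm (h z) \<le> K * exp (pi * \<delta>) * L * (1 / Im z) ^ N"
      by (simp add: mult_ac)
  qed
qed

section \<open>Chain bases and the growth of F at the cusp\<close>

lemma finite_chain_index: "finite (chain_index C)"
  by (simp add: chain_index_def)

lemma component_in_component_space:
  "(\<lambda>\<tau>. F \<tau> $ i) \<in> component_space F"
proof -
  have "(\<Sum>j\<in>UNIV. (if j = i then 1 else 0) * F \<tau> $ j) = F \<tau> $ i" for \<tau>
    by (simp add: if_distrib[where f = "\<lambda>c. c * _"] cong: if_cong)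
  then show ?thesis
    unfolding component_space_def uhp_span_def by (auto intro!: exI[of _ "\<lambda>j. if j = i then 1 else 0"])
qed

lemma chain_fun_in_component_space:
  assumes "chain_basis F C" "(r, j) \<in> chain_index C"
  shows "chain_fun (C ! r) j \<in> component_space F"
proof -
  have "(\<Sum>i\<in>chain_index C. (if i = (r, j) then 1 else 0) * chain_family C i \<tau>)
      = chain_fun (C ! r) j \<tau>" for \<tau>
    using assms(2) finite_chain_index[of C]
    by (simp add: if_distrib[where f = "\<lambda>c. c * _"] chain_family_def cong: if_cong)
  then have "chain_fun (C ! r) j \<in> uhp_span (chain_index C) (chain_family C)"
    unfolding uhp_span_def by (auto intro!: exI[of _ "\<lambda>i. if i = (r, j) then 1 else 0"])
  then show ?thesis using assms(1) by (simp add: chain_basis_def)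
qed

text \<open>The chain functions are independent and lie in the span of the \<open>p\<close>
  components of \<open>F\<close>, so there are at most \<open>p\<close> of them. This bounds the
  degree in \<open>\<tau>\<close> of every polynomial q-expansion independently of
  \<open>F\<close>.\<close>

lemma chain_length_le:
  fixes F :: "complex \<Rightarrow> complex^'p"
  assumes "chain_basis F C" "c \<in> set C"
  shows "chain_length c \<le> CARD('p)"
proof -
  have "card (chain_index C) \<le> CARD('p)"
  proof (rule ccontr)
    assume card: "\<not> card (chain_index C) \<le> CARD('p)"
    have "\<forall>i\<in>chain_index C. chain_family C i \<in> component_space F"
      using chain_fun_in_component_space[OF assms(1)] by (auto simp: chain_family_def)
    then have "\<forall>i\<in>chain_index C. \<exists>m. \<forall>\<tau>\<in>upper_half_plane.
        chain_family C i \<tau> = (\<Sum>l\<in>UNIV. m l * F \<tau> $ l)"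
      unfolding component_space_def uhp_span_def by blast
    then obtain m where m: "\<And>i \<tau>. i \<in> chain_index C \<Longrightarrow> \<tau> \<in> upper_half_plane \<Longrightarrow>
        chain_family C i \<tau> = (\<Sum>l\<in>UNIV. m i l * F \<tau> $ l)"
      by metis
    \<comment> \<open>Coordinates of the chain functions with respect to the components of
      \<open>F\<close>; a linear relation among these vectors is one among the functions.\<close>
    define v :: "nat \<times> nat \<Rightarrow> complex^'p" where "v i = (\<chi> l. m i l)" for i
    obtain d where d: "\<exists>i\<in>chain_index C. d i \<noteq> 0" "(\<Sum>i\<in>chain_index C. d i *s v i) = 0"
      using linear_relation_exists[OF finite_chain_index[of C], of v] card by auto
    have d0: "(\<Sum>i\<in>chain_index C. d i * m i l) = 0" for l
    proof -
      have "(\<Sum>i\<in>chain_index C. d i *s v i) $ l = 0" using d(2) by simp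
      then show ?thesis by (simp add: v_def)
    qed
    have "(\<Sum>i\<in>chain_index C. d i * chain_family C i \<tau>) = 0" if "\<tau> \<in> upper_half_plane" for \<tau>
    proof -
      have "(\<Sum>i\<in>chain_index C. d i * chain_family C i \<tau>)
          = (\<Sum>i\<in>chain_index C. \<Sum>l\<in>UNIV. d i * m i l * F \<tau> $ l)"
        using m that by (simp add: sum_distrib_left mult.assoc)
      also have "\<dots> = (\<Sum>l\<in>UNIV. (\<Sum>i\<in>chain_index C. d i * m i l) * F \<tau> $ l)"
        by (subst sum.swap) (simp add: sum_distrib_right)
      finally show ?thesis by (simp add: d0)
    qed
    then show False
      using assms(1) d(1) unfolding chain_basis_def uhp_independent_def by blast
  qed
  moreover obtain r where r: "r < length C" "c = C ! r"
    using assms(2) by (auto simp: in_set_conv_nth)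
  moreover have "card ({r} \<times> {..<chain_length c}) \<le> card (chain_index C)"
    using r by (intro card_mono finite_chain_index) (auto simp: chain_index_def)
  ultimately show ?thesis by (simp add: card_cartesian_product)
qed

text \<open>On the strip \<open>norm z\<close> is at most a multiple of \<open>Im z\<close>, so the
  binomials contribute at most \<open>Im z ^ p\<close> up to a constant. \<open>N = 0\<close> serves
  holomorphic forms and large \<open>N\<close> cuspidal ones.\<close>

lemma vvmf_growth_at_cusp:
  fixes F :: "complex \<Rightarrow> complex^'p"
  assumes exp: "log_q_expansion \<rho> F C"
    and bnd: "\<And>c t h. c \<in> set C \<Longrightarrow> t < chain_length c \<Longrightarrow>
      q_series_sums (exponent c) (chain_coeff c t) h \<Longrightarrow>
      \<exists>K\<ge>0. \<forall>z. 1/2 \<le> Im z \<longrightarrow> norm (h z) \<le> K * (1 / Im z) ^ N"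
  shows "\<exists>K\<ge>0. \<forall>z. 1/2 \<le> Im z \<longrightarrow> \<bar>Re z\<bar> \<le> 1/2 \<longrightarrow>
    norm (F z) \<le> K * (Im z ^ CARD('p) * (1 / Im z) ^ N)"
proof -
  have basis: "chain_basis F C" using exp by (simp add: log_q_expansion_def)
  let ?p = "CARD('p)"
  have chain: "\<exists>K\<ge>0. \<forall>z. 1/2 \<le> Im z \<longrightarrow> \<bar>Re z\<bar> \<le> 1/2 \<longrightarrow>
      norm (chain_family C i z) \<le> K * (Im z ^ ?p * (1 / Im z) ^ N)"
    if i: "i \<in> chain_index C" for i
  proof -
    obtain r j where rj: "i = (r, j)" "r < length C" "j < chain_length (C ! r)"
      using i by (auto simp: chain_index_def)
    define c where "c = C ! r"
    have c: "c \<in> set C" "j < chain_length c" using rj by (auto simp: c_def)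
    then obtain h where h: "\<And>t. t < chain_length c \<Longrightarrow> q_series_sums (exponent c) (chain_coeff c t) (h t)"
        "\<And>\<tau>. \<tau> \<in> upper_half_plane \<Longrightarrow> chain_fun c j \<tau> = (\<Sum>t\<le>j. (\<tau> gchoose t) * h (j - t) \<tau>)"
      using exp unfolding log_q_expansion_def polynomial_q_expansion_def by blast
    have "\<forall>t. \<exists>K. t < chain_length c \<longrightarrow> 0 \<le> K \<and>
        (\<forall>z. 1/2 \<le> Im z \<longrightarrow> norm (h t z) \<le> K * (1 / Im z) ^ N)"
      using bnd[OF c(1) _ h(1)] by blast
    then obtain K where K: "\<And>t. t < chain_length c \<Longrightarrow> 0 \<le> K t"
        "\<And>t z. t < chain_length c \<Longrightarrow> 1/2 \<le> Im z \<Longrightarrow> norm (h t z) \<le> K t * (1 / Im z) ^ N"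
      by metis
    have jp: "j < ?p" using chain_length_le[OF basis c(1)] c(2) by simp
    define L where "L = (\<Sum>t\<le>j. (2 * (1 + real ?p)) ^ ?p * K (j - t))"
    show ?thesis
    proof (intro exI[of _ L] conjI allI impI)
      show "0 \<le> L" unfolding L_def using K(1) c(2) by (intro sum_nonneg) auto
      fix z assume z: "1/2 \<le> Im z" "\<bar>Re z\<bar> \<le> 1/2"
      have nz: "norm z + real ?p \<le> (1 + real ?p) * (2 * Im z)"
      proof -
        have "norm z \<le> \<bar>Re z\<bar> + \<bar>Im z\<bar>" by (rule cmod_le)
        moreover have "real ?p * 1 \<le> real ?p * (2 * Im z)" using z by (intro mult_left_mono) auto
        ultimately show ?thesis using z unfolding distrib_right by linarith
      qed
      have bin: "norm (z gchoose t) \<le> (2 * (1 + real ?p)) ^ ?p * Im z ^ ?p" if "t \<le> j" for t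
      proof -
        have tp: "t \<le> ?p" using that jp by simp
        have "norm (z gchoose t) \<le> (norm z + real t) ^ t" by (rule norm_gbinomial_le)
        also have "\<dots> \<le> ((1 + real ?p) * (2 * Im z)) ^ t"
          using nz tp by (intro power_mono) (use of_nat_le_iff[of t ?p, where 'a = real] in linarith, simp)
        also have "\<dots> \<le> ((1 + real ?p) * (2 * Im z)) ^ ?p"
        \<comment> \<open>The factor 2 in the base matters: \<open>2 * Im z\<close> is at least 1,
          so the exponent may be raised from \<open>t\<close> to \<open>p\<close>.\<close>
        proof (intro power_increasing tp)
          have "1 * 1 \<le> (1 + real ?p) * (2 * Im z)" using z by (intro mult_mono) auto
          then show "1 \<le> (1 + real ?p) * (2 * Im z)" by simp
        qed
        also have "\<dots> = (2 * (1 + real ?p)) ^ ?p * Im z ^ ?p"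
          by (simp only: power_mult_distrib[symmetric] mult_ac)
        finally show ?thesis .
      qed
      have "chain_family C i z = (\<Sum>t\<le>j. (z gchoose t) * h (j - t) z)"
        using h(2) z by (simp add: chain_family_def rj(1) c_def upper_half_plane_def)
      also have "norm \<dots> \<le> (\<Sum>t\<le>j. ((2 * (1 + real ?p)) ^ ?p * Im z ^ ?p) * (K (j - t) * (1 / Im z) ^ N))"
      proof (intro sum_norm_le)
        fix t assume "t \<in> {..j}"
        then show "norm ((z gchoose t) * h (j - t) z)
            \<le> ((2 * (1 + real ?p)) ^ ?p * Im z ^ ?p) * (K (j - t) * (1 / Im z) ^ N)"
          unfolding norm_mult using z c(2) by (intro mult_mono bin K(2)) auto
      qed
      also have "\<dots> = L * (Im z ^ ?p * (1 / Im z) ^ N)"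
        unfolding L_def sum_distrib_right by (intro sum.cong) (auto simp: mult_ac)
      finally show "norm (chain_family C i z) \<le> L * (Im z ^ ?p * (1 / Im z) ^ N)" .
    qed
  qed
  then obtain K where K: "\<And>i. i \<in> chain_index C \<Longrightarrow> 0 \<le> K i"
    "\<And>i z. i \<in> chain_index C \<Longrightarrow> 1/2 \<le> Im z \<Longrightarrow> \<bar>Re z\<bar> \<le> 1/2 \<Longrightarrow>
      norm (chain_family C i z) \<le> K i * (Im z ^ ?p * (1 / Im z) ^ N)"
    by metis
  have "\<exists>d. \<forall>\<tau>\<in>upper_half_plane. F \<tau> $ l = (\<Sum>i\<in>chain_index C. d i * chain_family C i \<tau>)" for l
  proof -
    have "(\<lambda>\<tau>. F \<tau> $ l) \<in> uhp_span (chain_index C) (chain_family C)"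
      using component_in_component_space[of F l] basis by (simp add: chain_basis_def)
    then show ?thesis unfolding uhp_span_def by blast
  qed
  then obtain d where d: "\<And>l \<tau>. \<tau> \<in> upper_half_plane \<Longrightarrow>
      F \<tau> $ l = (\<Sum>i\<in>chain_index C. d l i * chain_family C i \<tau>)"
    by metis
  show ?thesis
  proof (intro exI[of _ "\<Sum>l\<in>UNIV. \<Sum>i\<in>chain_index C. norm (d l i) * K i"] conjI allI impI)
    show "0 \<le> (\<Sum>l\<in>UNIV. \<Sum>i\<in>chain_index C. norm (d l i) * K i)"
      using K(1) by (intro sum_nonneg) auto
    fix z :: complex assume z: "1/2 \<le> Im z" "\<bar>Re z\<bar> \<le> 1/2"
    have "norm (F z $ l) \<le> (\<Sum>i\<in>chain_index C. norm (d l i) * (K i * (Im z ^ ?p * (1 / Im z) ^ N)))" for l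
    proof -
      have "F z $ l = (\<Sum>i\<in>chain_index C. d l i * chain_family C i z)"
        using z by (intro d) (simp add: upper_half_plane_def)
      also have "norm \<dots> \<le> (\<Sum>i\<in>chain_index C. norm (d l i) * (K i * (Im z ^ ?p * (1 / Im z) ^ N)))"
        unfolding norm_mult by (intro sum_norm_le) (auto simp only: norm_mult intro!: mult_left_mono K(2) z norm_ge_zero)
      finally show ?thesis .
    qed
    then have "(\<Sum>l\<in>UNIV. norm (F z $ l)) \<le>
        (\<Sum>l\<in>UNIV. \<Sum>i\<in>chain_index C. norm (d l i) * (K i * (Im z ^ ?p * (1 / Im z) ^ N)))"
      by (intro sum_mono)
    moreover have "norm (F z) \<le> (\<Sum>l\<in>UNIV. norm (F z $ l))"
      unfolding norm_vec_def by (rule L2_set_le_sum) simp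
    ultimately show "norm (F z) \<le> (\<Sum>l\<in>UNIV. \<Sum>i\<in>chain_index C. norm (d l i) * K i) * (Im z ^ ?p * (1 / Im z) ^ N)"
      by (simp add: sum_distrib_right mult.assoc)
  qed
qed

section \<open>Estimating Fourier coefficients\<close>

lemma has_integral_exp_character:
  fixes l :: int
  shows "((\<lambda>x::real. exp (2 * of_real pi * \<i> * of_int l * of_real x))
    has_integral (if l = 0 then 1 else 0)) {-1/2..1/2}"
proof (cases "l = 0")
  case True
  then show ?thesis
    using has_integral_const_real[of "1::complex" "-1/2" "1/2"] by simp
next
  case False
  define w where "w = 2 * of_real pi * \<i> * (of_int l :: complex)"
  have w: "w \<noteq> 0" using False by (simp add: w_def)
  have "((\<lambda>x::real. exp (w * of_real x)) has_integral
      exp (w * of_real (1/2)) / w - exp (w * of_real (-1/2)) / w) {-1/2..1/2}"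
    by (rule fundamental_theorem_of_calculus)
       (auto intro!: derivative_eq_intros has_vector_derivative_real_field simp: w)
  moreover have "exp (w * of_real (1/2)) = exp (w * of_real (-1/2))"
  proof -
    have "w * of_real (1/2) = w * of_real (-1/2) + of_real (of_int (2 * l) * pi) * \<i>"
      by (simp add: w_def)
    then show ?thesis
      unfolding exp_eq by blast
  qed
  ultimately show ?thesis using False by (simp add: w_def)
qed

text \<open>Multiplying by the unimodular function \<open>e\<close> cancels the shift
  \<open>\<mu>\<close> together with the frequency \<open>n\<close>; integrating over an interval of
  length 1 then leaves only the term with index \<open>n\<close>.\<close>

lemma q_polynomial_coeff_bound:
  fixes a :: "int \<Rightarrow> complex"
  assumes "finite A" "n \<in> A" "0 \<le> B"
    and bnd: "\<And>x. \<bar>x\<bar> \<le> 1/2 \<Longrightarrow>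
      norm (\<Sum>m\<in>A. a m * exp (2 * of_real pi * \<i> * of_real (of_int m + \<mu>) * Complex x y)) \<le> B"
  shows "norm (a n) * exp (- 2 * pi * (of_int n + \<mu>) * y) \<le> B"
proof -
  define b where "b m = a m * exp (2 * of_real pi * \<i> * of_real (of_int m + \<mu>) * (\<i> * of_real y))" for m
  define e where "e x = exp (- (2 * of_real pi * \<i> * of_real (of_int n + \<mu>) * of_real x))" for x :: real
  have e: "norm (e x) = 1" for x
    unfolding e_def by (simp add: norm_exp_eq_Re)
  have eq: "(\<Sum>m\<in>A. a m * exp (2 * of_real pi * \<i> * of_real (of_int m + \<mu>) * Complex x y)) * e x
      = (\<Sum>m\<in>A. b m * exp (2 * of_real pi * \<i> * of_int (m - n) * of_real x))" for x
    unfolding sum_distrib_right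
  proof (intro sum.cong refl)
    fix m
    have "2 * of_real pi * \<i> * of_real (of_int m + \<mu>) * Complex x y
        + - (2 * of_real pi * \<i> * of_real (of_int n + \<mu>) * of_real x)
      = 2 * of_real pi * \<i> * of_real (of_int m + \<mu>) * (\<i> * of_real y)
        + 2 * of_real pi * \<i> * of_int (m - n) * of_real x"
      unfolding Complex_eq by (simp add: algebra_simps)
    then show "a m * exp (2 * of_real pi * \<i> * of_real (of_int m + \<mu>) * Complex x y) * e x
      = b m * exp (2 * of_real pi * \<i> * of_int (m - n) * of_real x)"
      unfolding b_def e_def mult.assoc[of "a m"] exp_add[symmetric] by simp
  qed
  have "((\<lambda>x. \<Sum>m\<in>A. b m * exp (2 * of_real pi * \<i> * of_int (m - n) * of_real x))
      has_integral (\<Sum>m\<in>A. b m * (if m - n = 0 then 1 else 0))) {-1/2..1/2}"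
    by (intro has_integral_sum assms(1) has_integral_mult_right has_integral_exp_character)
  also have "(\<Sum>m\<in>A. b m * (if m - n = 0 then 1 else 0)) = b n"
    using assms(1,2) by (simp add: if_distrib cong: if_cong)
  finally have "norm (b n) \<le> B * measure lborel (cbox (-1/2) (1/2 :: real))"
    unfolding eq[symmetric]
  proof (intro has_integral_bound[OF assms(3)])
    fix x :: real assume "x \<in> cbox (-1/2) (1/2)"
    then have "\<bar>x\<bar> \<le> 1/2" by auto
    then show "norm ((\<Sum>m\<in>A. a m * exp (2 * of_real pi * \<i> * of_real (of_int m + \<mu>) * Complex x y))
        * e x) \<le> B"
      unfolding norm_mult e mult_1_right by (rule bnd)
  qed simp
  moreover have "norm (b n) = norm (a n) * exp (- 2 * pi * (of_int n + \<mu>) * y)"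
    unfolding b_def norm_q_term by simp
  ultimately show ?thesis by simp
qed

text \<open>One finite set works for all \<open>x\<close> at once, because the norms of the terms
  depend only on \<open>y\<close>.\<close>

lemma q_series_tail_bound:
  assumes q: "q_series_sums \<mu> a h" and y: "0 < y" and "0 < \<epsilon>"
  obtains A where "finite A" "n \<in> A"
    "\<And>x. norm (h (Complex x y)
       - (\<Sum>m\<in>A. a m * exp (2 * of_real pi * \<i> * of_real (of_int m + \<mu>) * Complex x y))) \<le> \<epsilon>"
proof -
  define f where "f = (\<lambda>n. norm (a n) * exp (- 2 * pi * (of_int n + \<mu>) * y))"
  have f: "f summable_on UNIV"
    unfolding f_def by (rule q_series_summable[OF q y])
  obtain A0 where A0: "finite A0" "dist (sum f A0) (infsum f UNIV) \<le> \<epsilon>"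
    using infsum_finite_approximation[OF f \<open>0 < \<epsilon>\<close>] by blast
  define A where "A = insert n A0"
  have A: "finite A" using A0(1) by (simp add: A_def)
  have "sum f A0 \<le> sum f A"
    unfolding A_def by (intro sum_mono2) (use A0(1) in \<open>auto simp: f_def\<close>)
  then have tail: "infsum f UNIV - sum f A \<le> \<epsilon>"
    using A0(2) by (simp add: dist_real_def)
  show ?thesis
  proof (rule that[OF A])
    show "n \<in> A" by (simp add: A_def)
    fix x
    let ?g = "\<lambda>m. a m * exp (2 * of_real pi * \<i> * of_real (of_int m + \<mu>) * Complex x y)"
    have ng: "(\<lambda>m. norm (?g m)) = f"
      unfolding norm_q_term f_def by simp
    have "(?g has_sum h (Complex x y)) UNIV"
      by (rule q_series_sums_at[OF q]) (simp add: y)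
    then have "(?g has_sum (h (Complex x y) - sum ?g A)) (UNIV - A)"
      by (intro has_sum_Diff has_sum_finite A) auto
    moreover have "(f has_sum (infsum f UNIV - sum f A)) (UNIV - A)"
      by (intro has_sum_Diff has_sum_finite A has_sum_infsum f) auto
    ultimately have "norm (h (Complex x y) - sum ?g A) \<le> infsum f UNIV - sum f A"
      unfolding ng[symmetric] by (rule norm_has_sum_bound[rotated])
    with tail show "norm (h (Complex x y) - sum ?g A) \<le> \<epsilon>" by simp
  qed
qed

text \<open>A finite partial sum containing the index \<open>n\<close> obeys the bound
  \<open>B + \<epsilon>\<close>, so the Fourier integral is taken of finite sums only, and
  \<open>\<epsilon>\<close> is arbitrary.\<close>

lemma q_series_coeff_bound:
  assumes q: "q_series_sums \<mu> a h" and y: "0 < y"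
    and bnd: "\<And>x. \<bar>x\<bar> \<le> 1/2 \<Longrightarrow> norm (h (Complex x y)) \<le> B"
  shows "norm (a n) * exp (- 2 * pi * (of_int n + \<mu>) * y) \<le> B"
proof (rule field_le_epsilon)
  fix \<epsilon> :: real assume \<epsilon>: "0 < \<epsilon>"
  obtain A where A: "finite A" "n \<in> A"
    "\<And>x. norm (h (Complex x y)
       - (\<Sum>m\<in>A. a m * exp (2 * of_real pi * \<i> * of_real (of_int m + \<mu>) * Complex x y))) \<le> \<epsilon>"
    using q_series_tail_bound[OF q y \<epsilon>] by blast
  have "0 \<le> B" using order.trans[OF norm_ge_zero bnd[of 0]] by simp
  then show "norm (a n) * exp (- 2 * pi * (of_int n + \<mu>) * y) \<le> B + \<epsilon>"
  proof (intro q_polynomial_coeff_bound[OF A(1,2)])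
    fix x :: real assume "\<bar>x\<bar> \<le> 1/2"
    then show "norm (\<Sum>m\<in>A. a m * exp (2 * of_real pi * \<i> * of_real (of_int m + \<mu>) * Complex x y)) \<le> B + \<epsilon>"
      using A(3)[of x] bnd[of x] norm_triangle_sub[of "\<Sum>m\<in>A. a m * exp (2 * of_real pi * \<i> * of_real (of_int m + \<mu>) * Complex x y)" "h (Complex x y)"]
      by (simp add: norm_minus_commute)
  qed (use \<epsilon> in simp)
qed

text \<open>The triangular system \<open>g j = (\<Sum>t\<le>j. (\<tau> gchoose t) * h (j - t))\<close> is unipotent, so it can be solved for the \<open>h j\<close>
  with coefficients that are bounded on bounded sets.\<close>

lemma chain_series_bound:
  assumes g: "\<And>j \<tau>. j < m \<Longrightarrow> \<tau> \<in> upper_half_plane \<Longrightarrow>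
      g j \<tau> = (\<Sum>t\<le>j. (\<tau> gchoose t) * h (j - t) \<tau> :: complex)"
    and "j < m"
  shows "\<exists>K\<ge>0. \<forall>\<tau> B. \<tau> \<in> upper_half_plane \<longrightarrow> norm \<tau> \<le> 2 \<longrightarrow>
      (\<forall>i<m. norm (g i \<tau>) \<le> B) \<longrightarrow> norm (h j \<tau>) \<le> K * B"
  using assms(2)
proof (induction j rule: less_induct)
  case (less j)
  have "\<forall>i. \<exists>K. i < j \<longrightarrow> 0 \<le> K \<and> (\<forall>\<tau> B. \<tau> \<in> upper_half_plane \<longrightarrow> norm \<tau> \<le> 2 \<longrightarrow>
      (\<forall>i<m. norm (g i \<tau>) \<le> B) \<longrightarrow> norm (h i \<tau>) \<le> K * B)"
    using less.IH less.prems by (meson less_trans)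
  then obtain K where K: "\<And>i. i < j \<Longrightarrow> 0 \<le> K i"
    "\<And>i \<tau> B. i < j \<Longrightarrow> \<tau> \<in> upper_half_plane \<Longrightarrow> norm \<tau> \<le> 2 \<Longrightarrow>
      (\<forall>i<m. norm (g i \<tau>) \<le> B) \<Longrightarrow> norm (h i \<tau>) \<le> K i * B"
    by metis
  \<comment> \<open>The 1 accounts for \<open>g j\<close>; \<open>(2 + t) ^ t\<close> bounds the
    binomial \<open>\<tau> gchoose t\<close> for \<open>norm \<tau> \<le> 2\<close>.\<close>
  define L where "L = 1 + (\<Sum>t\<in>{1..j}. (2 + real t) ^ t * K (j - t))"
  show ?case
  proof (intro exI[of _ L] conjI allI impI)
    show "0 \<le> L" unfolding L_def
      using K(1) by (intro add_nonneg_nonneg sum_nonneg mult_nonneg_nonneg) auto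
    fix \<tau> B
    assume \<tau>: "\<tau> \<in> upper_half_plane" "norm \<tau> \<le> 2" and B: "\<forall>i<m. norm (g i \<tau>) \<le> B"
    have "{..j} = insert 0 {1..j}" by auto
    then have "h j \<tau> = g j \<tau> - (\<Sum>t\<in>{1..j}. (\<tau> gchoose t) * h (j - t) \<tau>)"
      using g[OF less.prems \<tau>(1)] by simp
    also have "norm \<dots> \<le> norm (g j \<tau>) + norm (\<Sum>t\<in>{1..j}. (\<tau> gchoose t) * h (j - t) \<tau>)"
      by (rule norm_triangle_ineq4)
    also have "\<dots> \<le> B + (\<Sum>t\<in>{1..j}. (2 + real t) ^ t * (K (j - t) * B))"
    proof (intro add_mono sum_norm_le)
      show "norm (g j \<tau>) \<le> B" using B less.prems by blast
      fix t assume t: "t \<in> {1..j}"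
      have "norm (\<tau> gchoose t) \<le> (norm \<tau> + real t) ^ t" by (rule norm_gbinomial_le)
      also have "\<dots> \<le> (2 + real t) ^ t" using \<tau> by (intro power_mono) auto
      finally show "norm ((\<tau> gchoose t) * h (j - t) \<tau>) \<le> (2 + real t) ^ t * (K (j - t) * B)"
        unfolding norm_mult using t \<tau> B by (intro mult_mono K(2)) auto
    qed
    also have "\<dots> = L * B"
      by (simp add: L_def algebra_simps sum_distrib_left sum_distrib_right)
    finally show "norm (h j \<tau>) \<le> L * B" .
  qed
qed

section \<open>From the vector-valued form to its coefficients\<close>

lemma component_space_bound:
  fixes F :: "complex \<Rightarrow> complex^'p"
  assumes "g \<in> component_space F"
  obtains K where "0 \<le> K" "\<And>\<tau>. \<tau> \<in> upper_half_plane \<Longrightarrow> norm (g \<tau>) \<le> K * norm (F \<tau>)"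
proof -
  obtain m where m: "\<And>\<tau>. \<tau> \<in> upper_half_plane \<Longrightarrow> g \<tau> = (\<Sum>l\<in>UNIV. m l * F \<tau> $ l)"
    using assms unfolding component_space_def uhp_span_def by blast
  show ?thesis
  proof (rule that[of "\<Sum>l\<in>UNIV. norm (m l)"])
    show "0 \<le> (\<Sum>l\<in>UNIV. norm (m l))" by (simp add: sum_nonneg)
    fix \<tau> assume "\<tau> \<in> upper_half_plane"
    then have "g \<tau> = (\<Sum>l\<in>UNIV. m l * F \<tau> $ l)" by (rule m)
    also have "norm \<dots> \<le> (\<Sum>l\<in>UNIV. norm (m l) * norm (F \<tau>))"
      by (intro sum_norm_le)
        (auto simp: norm_mult intro!: mult_left_mono Finite_Cartesian_Product.norm_nth_le)
    finally have "norm (g \<tau>) \<le> (\<Sum>l\<in>UNIV. norm (m l) * norm (F \<tau>))" .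
    then show "norm (g \<tau>) \<le> (\<Sum>l\<in>UNIV. norm (m l)) * norm (F \<tau>)"
      by (simp add: sum_distrib_right)
  qed
qed

text \<open>The components of \<open>F\<close> bound the chain functions, these bound the q-series
  by solving the triangular system, and the Fourier integral at height \<open>y\<close> bounds the
  coefficient. The condition \<open>y \<le> 1\<close> keeps the points within
  \<open>norm \<tau> \<le> 2\<close>. The constants may depend on the chosen chains, but not on
  \<open>y\<close>, \<open>B\<close> or \<open>n\<close>.\<close>

lemma fourier_coeff_bound:
  fixes F :: "complex \<Rightarrow> complex^'p"
  assumes "is_fourier_coeff \<rho> F a"
  obtains K \<mu> where "0 \<le> K"
    "\<And>y B n. 0 < y \<Longrightarrow> y \<le> 1 \<Longrightarrow>
       (\<And>\<tau>. \<bar>Re \<tau>\<bar> \<le> 1/2 \<Longrightarrow> Im \<tau> = y \<Longrightarrow> norm (F \<tau>) \<le> B) \<Longrightarrow>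
       norm (a n) * exp (- 2 * pi * (of_int n + \<mu>) * y) \<le> K * B"
proof -
  obtain C c t where C: "log_q_expansion \<rho> F C" "c \<in> set C" "t < chain_length c" "a = chain_coeff c t"
    using assms unfolding is_fourier_coeff_def by blast
  then obtain h where h: "\<And>t. t < chain_length c \<Longrightarrow> q_series_sums (exponent c) (chain_coeff c t) (h t)"
      "\<And>j \<tau>. j < chain_length c \<Longrightarrow> \<tau> \<in> upper_half_plane \<Longrightarrow>
        chain_fun c j \<tau> = (\<Sum>t\<le>j. (\<tau> gchoose t) * h (j - t) \<tau>)"
    unfolding log_q_expansion_def polynomial_q_expansion_def by blast
  obtain L where L: "0 \<le> L" "\<And>\<tau> B. \<tau> \<in> upper_half_plane \<Longrightarrow> norm \<tau> \<le> 2 \<Longrightarrow>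
      (\<forall>i<chain_length c. norm (chain_fun c i \<tau>) \<le> B) \<Longrightarrow> norm (h t \<tau>) \<le> L * B"
    using chain_series_bound[OF h(2) C(3)] by blast
  obtain r where r: "r < length C" "c = C ! r"
    using C(2) by (auto simp: in_set_conv_nth)
  have "\<forall>j. \<exists>M. j < chain_length c \<longrightarrow> 0 \<le> M \<and>
      (\<forall>\<tau>\<in>upper_half_plane. norm (chain_fun c j \<tau>) \<le> M * norm (F \<tau>))"
  proof (intro allI)
    fix j
    show "\<exists>M. j < chain_length c \<longrightarrow> 0 \<le> M \<and>
      (\<forall>\<tau>\<in>upper_half_plane. norm (chain_fun c j \<tau>) \<le> M * norm (F \<tau>))"
    proof (cases "j < chain_length c")
      case True
      then have "(r, j) \<in> chain_index C" using r by (simp add: chain_index_def)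
      then have "chain_fun c j \<in> component_space F"
        using C(1) chain_fun_in_component_space r(2) unfolding log_q_expansion_def by blast
      then show ?thesis by (rule component_space_bound) blast
    qed simp
  qed
  then obtain M where M: "\<And>j. j < chain_length c \<Longrightarrow> 0 \<le> M j"
      "\<And>j \<tau>. j < chain_length c \<Longrightarrow> \<tau> \<in> upper_half_plane \<Longrightarrow> norm (chain_fun c j \<tau>) \<le> M j * norm (F \<tau>)"
    by metis
  define S where "S = (\<Sum>j<chain_length c. M j)"
  have MS: "M j \<le> S" if "j < chain_length c" for j
    unfolding S_def using M(1) that by (intro member_le_sum) auto
  have S0: "0 \<le> S" unfolding S_def using M(1) by (intro sum_nonneg) auto
  show ?thesis
  proof (rule that[of "L * S" "exponent c"])
    show "0 \<le> L * S" using L(1) S0 by simp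
    fix y B n
    assume y: "0 < y" "y \<le> 1"
      and B: "\<And>\<tau>. \<bar>Re \<tau>\<bar> \<le> 1/2 \<Longrightarrow> Im \<tau> = y \<Longrightarrow> norm (F \<tau>) \<le> B"
    show "norm (a n) * exp (- 2 * pi * (of_int n + exponent c) * y) \<le> L * S * B"
      unfolding C(4)
    proof (rule q_series_coeff_bound[OF h(1)[OF C(3)] y(1)])
      fix x :: real assume x: "\<bar>x\<bar> \<le> 1/2"
      have \<tau>: "Complex x y \<in> upper_half_plane" using y by (simp add: upper_half_plane_def)
      have "norm (Complex x y) \<le> \<bar>x\<bar> + \<bar>y\<bar>"
        using cmod_le[of "Complex x y"] by simp
      then have "norm (Complex x y) \<le> 2" using x y by simp
      moreover have "norm (chain_fun c i (Complex x y)) \<le> S * B" if "i < chain_length c" for i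
      proof -
        have "norm (chain_fun c i (Complex x y)) \<le> M i * norm (F (Complex x y))"
          by (rule M(2)[OF that \<tau>])
        also have "\<dots> \<le> S * B"
          using x S0 by (intro mult_mono MS that B) auto
        finally show ?thesis .
      qed
      ultimately have "norm (h t (Complex x y)) \<le> L * (S * B)"
        by (intro L(2) \<tau>) auto
      then show "norm (h t (Complex x y)) \<le> L * S * B" by (simp add: mult.assoc)
    qed
  qed
qed

section \<open>From power bounds on the strip to coefficient estimates\<close>

lemma reduced_Im_le:
  fixes c d :: int
  assumes "(c, d) \<noteq> (0, 0)" "Im z * (norm (of_int c * \<tau> + of_int d))\<^sup>2 = Im \<tau>"
    and \<tau>: "0 < Im \<tau>" "Im \<tau> \<le> 1" and z: "0 < Im z"
  shows "Im z \<le> 1 / Im \<tau>"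
proof -
  \<comment> \<open>If \<open>c\<close> is nonzero, the imaginary part alone is large enough; if
    \<open>c = 0\<close>, then \<open>|d| \<ge> 1 \<ge> Im \<tau>\<close>.\<close>
  have "Im \<tau> \<le> norm (of_int c * \<tau> + of_int d)"
  proof (cases "c = 0")
    case True
    then have "1 \<le> \<bar>d\<bar>" using assms(1) by auto
    then have "1 \<le> norm (of_int d :: complex)" by simp
    then show ?thesis using \<tau> True by simp
  next
    case False
    then have "1 \<le> \<bar>c\<bar>" by auto
    then have "1 * Im \<tau> \<le> real_of_int \<bar>c\<bar> * Im \<tau>"
      using \<tau> by (intro mult_right_mono) linarith+
    also have "\<dots> = \<bar>Im (of_int c * \<tau> + of_int d)\<bar>" using \<tau> by (simp add: abs_mult)
    also have "\<dots> \<le> norm (of_int c * \<tau> + of_int d)" by (rule abs_Im_le_cmod)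
    finally show ?thesis by simp
  qed
  then have "Im z * (Im \<tau>)\<^sup>2 \<le> Im \<tau>"
    using assms(2) z \<tau> by (metis less_imp_le mult_left_mono power_mono)
  then show ?thesis using \<tau> by (simp add: field_simps power2_eq_square)
qed

lemma powr_le_half_powr:
  assumes "e \<le> 0" "1/2 \<le> (x::real)"
  shows "x powr e \<le> (1/2) powr e"
  using powr_mono2'[of e "1/2" x] assms by simp

text \<open>At height \<open>y = 1/n\<close> the exponential weight of the \<open>n\<close>-th
  coefficient is bounded below independently of \<open>n\<close>, while the bound for
  \<open>F\<close> becomes a multiple of \<open>n powr E\<close>.\<close>

lemma bigo_powr_of_strip_bound:
  fixes F :: "complex \<Rightarrow> complex^'p"
  assumes fc: "is_fourier_coeff \<rho> F a"
    and F: "\<And>\<tau>. \<bar>Re \<tau>\<bar> \<le> 1/2 \<Longrightarrow> 0 < Im \<tau> \<Longrightarrow> Im \<tau> \<le> 1 \<Longrightarrow> norm (F \<tau>) \<le> K * (1 / Im \<tau>) powr E"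
    and "E \<le> E'"
  shows "(\<lambda>n::nat. norm (a (int n))) \<in> O(\<lambda>n. real n powr E')"
proof -
  obtain L \<mu> where L: "0 \<le> L"
    "\<And>y B n. 0 < y \<Longrightarrow> y \<le> 1 \<Longrightarrow>
       (\<And>\<tau>. \<bar>Re \<tau>\<bar> \<le> 1/2 \<Longrightarrow> Im \<tau> = y \<Longrightarrow> norm (F \<tau>) \<le> B) \<Longrightarrow>
       norm (a n) * exp (- 2 * pi * (of_int n + \<mu>) * y) \<le> L * B"
    using fourier_coeff_bound[OF fc] by blast
  have K: "0 \<le> K"
    using order.trans[OF norm_ge_zero F[of \<i>]] by simp
  have "norm (a (int n)) \<le> (exp (2 * pi * (1 + \<bar>\<mu>\<bar>)) * L * K) * real n powr E'" if n: "1 \<le> n" for n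
  proof -
    define y where "y = 1 / real n"
    have y: "0 < y" "y \<le> 1" using n by (simp_all add: y_def)
    have "norm (a (int n)) * exp (- 2 * pi * (of_int (int n) + \<mu>) * y) \<le> L * (K * (1 / y) powr E)"
      by (rule L(2)[OF y]) (use F y in auto)
    moreover have "exp (- (2 * pi * (1 + \<bar>\<mu>\<bar>))) \<le> exp (- 2 * pi * (of_int (int n) + \<mu>) * y)"
    proof -
      have "\<mu> * y \<le> \<bar>\<mu>\<bar> * 1" using y by (intro mult_mono) auto
      moreover have "real n * y = 1" using n by (simp add: y_def)
      ultimately have "(real n + \<mu>) * y \<le> 1 + \<bar>\<mu>\<bar>" by (simp add: distrib_right)
      then have "2 * pi * ((real n + \<mu>) * y) \<le> 2 * pi * (1 + \<bar>\<mu>\<bar>)" by (intro mult_left_mono) auto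
      then show ?thesis by (simp add: mult.assoc)
    qed
    ultimately have "norm (a (int n)) * exp (- (2 * pi * (1 + \<bar>\<mu>\<bar>))) \<le> L * (K * (1 / y) powr E)"
      by (meson mult_left_mono norm_ge_zero order.trans)
    then have "norm (a (int n)) * exp (- (2 * pi * (1 + \<bar>\<mu>\<bar>))) \<le> L * (K * real n powr E)"
      by (simp add: y_def)
    then have "norm (a (int n)) \<le> exp (2 * pi * (1 + \<bar>\<mu>\<bar>)) * L * K * real n powr E"
      unfolding exp_minus by (simp add: divide_inverse[symmetric] pos_divide_le_eq mult_ac)
    also have "\<dots> \<le> exp (2 * pi * (1 + \<bar>\<mu>\<bar>)) * L * K * real n powr E'"
      using n K L(1) \<open>E \<le> E'\<close> by (intro mult_left_mono powr_mono) auto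
    finally show ?thesis .
  qed
  then show ?thesis
    by (intro bigoI[of _ "exp (2 * pi * (1 + \<bar>\<mu>\<bar>)) * L * K"] eventually_at_top_linorderI[of 1]) simp
qed

text \<open>For fixed \<open>n\<close> the height tends to 0: the exponential weight tends to 1,
  while the bound for \<open>F\<close> tends to 0 since \<open>E\<close> is negative.\<close>

lemma fourier_coeff_eq_0_of_strip_bound:
  fixes F :: "complex \<Rightarrow> complex^'p"
  assumes fc: "is_fourier_coeff \<rho> F a"
    and F: "\<And>\<tau>. \<bar>Re \<tau>\<bar> \<le> 1/2 \<Longrightarrow> 0 < Im \<tau> \<Longrightarrow> Im \<tau> \<le> 1 \<Longrightarrow> norm (F \<tau>) \<le> K * (1 / Im \<tau>) powr E"
    and "E < 0"
  shows "a n = 0"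
proof -
  obtain L \<mu> where L: "0 \<le> L"
    "\<And>y B n. 0 < y \<Longrightarrow> y \<le> 1 \<Longrightarrow>
       (\<And>\<tau>. \<bar>Re \<tau>\<bar> \<le> 1/2 \<Longrightarrow> Im \<tau> = y \<Longrightarrow> norm (F \<tau>) \<le> B) \<Longrightarrow>
       norm (a n) * exp (- 2 * pi * (of_int n + \<mu>) * y) \<le> L * B"
    using fourier_coeff_bound[OF fc] by blast
  let ?l = "\<lambda>j::nat. norm (a n) * exp (- 2 * pi * (of_int n + \<mu>) * (1 / real (Suc j)))"
  have "?l \<longlonglongrightarrow> norm (a n) * exp (- 2 * pi * (of_int n + \<mu>) * 0)"
    using LIMSEQ_inverse_real_of_nat by (intro tendsto_intros) (simp add: inverse_eq_divide)
  moreover have "(\<lambda>j. L * (K * real (Suc j) powr E)) \<longlonglongrightarrow> L * (K * 0)"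
    by (intro tendsto_intros tendsto_neg_powr \<open>E < 0\<close>
        filterlim_compose[OF filterlim_real_sequentially filterlim_Suc])
  moreover have "?l j \<le> L * (K * real (Suc j) powr E)" for j
  proof (rule L(2))
    fix \<tau> assume \<tau>: "\<bar>Re \<tau>\<bar> \<le> 1/2" "Im \<tau> = 1 / real (Suc j)"
    then show "norm (F \<tau>) \<le> K * real (Suc j) powr E"
      using F[OF \<tau>(1)] by simp
  qed auto
  ultimately have "norm (a n) * exp (- 2 * pi * (of_int n + \<mu>) * 0) \<le> L * (K * 0)"
    by (intro LIMSEQ_le) auto
  then show ?thesis by simp
qed

theorem theorem3p6:
  fixes \<rho> :: "int^2^2 \<Rightarrow> complex^'p^'p"
  assumes "SL2Z_representation \<rho>"
    and "\<And>z. is_eigenvalue (\<rho> T_mat) z \<Longrightarrow> norm z = 1"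
  shows "\<exists>\<alpha>::real. \<forall>k::real. \<forall>F \<in> hol_log_vvmf k \<rho>.
           (\<forall>a. is_fourier_coeff \<rho> F a \<longrightarrow>
              (\<lambda>n::nat. norm (a (int n))) \<in> O(\<lambda>n. real n powr (k + \<alpha>))) \<and>
           (log_cuspidal \<rho> F \<longrightarrow>
              (\<forall>a. is_fourier_coeff \<rho> F a \<longrightarrow>
                 (\<lambda>n::nat. norm (a (int n))) \<in> O(\<lambda>n. real n powr ((k + \<alpha>) / 2))))"
proof -
  obtain \<beta> where \<beta>: "0 \<le> \<beta>"
    "\<And>k F \<tau>. vvmf k \<rho> F \<Longrightarrow> \<bar>Re \<tau>\<bar> \<le> 1/2 \<Longrightarrow> 0 < Im \<tau> \<Longrightarrow>
       \<exists>z c d. \<bar>Re z\<bar> \<le> 1/2 \<and> 1/2 \<le> Im z \<and> (c, d) \<noteq> (0, 0) \<and>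
         Im z * (norm (of_int c * \<tau> + of_int d))\<^sup>2 = Im \<tau> \<and>
         norm (F \<tau>) \<le> (Im z / Im \<tau>) powr (\<beta> + k/2) * norm (F z)"
    using vvmf_reduction_bound[OF assms] by metis
  define p where "p = CARD('p)"
  \<comment> \<open>With \<open>e = \<beta> + k/2\<close> this makes
    \<open>k + \<alpha> = 2 * (e + p)\<close>, so \<open>k + \<alpha>\<close> and
    \<open>e + p\<close> have the same sign. The exponents reached below are
    \<open>2 * e + p\<close> for holomorphic forms with \<open>e + p \<ge> 0\<close>, at most
    \<open>k + \<alpha>\<close>, and \<open>e\<close> for cuspidal ones, at most
    \<open>(k + \<alpha>) / 2\<close>.\<close>
  define \<alpha> where "\<alpha> = 2 * \<beta> + 2 * real p"
  show ?thesis
  proof (intro exI[of _ \<alpha>] allI ballI)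
    fix k :: real and F assume "F \<in> hol_log_vvmf k \<rho>"
    then have F: "vvmf k \<rho> F" "log_holomorphic \<rho> F" by (auto simp: hol_log_vvmf_def)
    define e where "e = \<beta> + k/2"
    have reduce: "\<exists>z. 1/2 \<le> Im z \<and> Im z \<le> 1 / Im \<tau> \<and>
        norm (F \<tau>) \<le> K * ((1 / Im \<tau>) powr e * Im z powr (e + real p - real N))"
      if K: "0 \<le> K" "\<And>z. 1/2 \<le> Im z \<Longrightarrow> \<bar>Re z\<bar> \<le> 1/2 \<Longrightarrow>
          norm (F z) \<le> K * (Im z ^ p * (1 / Im z) ^ N)"
        and \<tau>: "\<bar>Re \<tau>\<bar> \<le> 1/2" "0 < Im \<tau>" "Im \<tau> \<le> 1" for K N \<tau>
    proof -
      obtain z c d where z: "\<bar>Re z\<bar> \<le> 1/2" "1/2 \<le> Im z" "(c, d) \<noteq> (0, 0)"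
          "Im z * (norm (of_int c * \<tau> + of_int d))\<^sup>2 = Im \<tau>"
          "norm (F \<tau>) \<le> (Im z / Im \<tau>) powr e * norm (F z)"
        using \<beta>(2)[OF F(1) \<tau>(1,2)] unfolding e_def by (elim exE conjE)
      have z0: "0 < Im z" using z(2) by simp
      have "norm (F \<tau>) \<le> (Im z / Im \<tau>) powr e * (K * (Im z ^ p * (1 / Im z) ^ N))"
        using z(5) by (rule order.trans) (intro mult_left_mono K(2) z, simp)
      also have "Im z ^ p * (1 / Im z) ^ N = Im z powr (real p - real N)"
        using z0 by (simp add: powr_diff powr_realpow power_divide)
      also have "(Im z / Im \<tau>) powr e = (1 / Im \<tau>) powr e * Im z powr e"
        using z0 \<tau> by (simp add: powr_divide)
      finally have "norm (F \<tau>) \<le> K * ((1 / Im \<tau>) powr e * Im z powr (e + (real p - real N)))"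
        unfolding powr_add by (simp add: mult_ac)
      then show ?thesis
        using z(2) reduced_Im_le[OF z(3,4) \<tau>(2,3) z0] by (auto simp: add_diff_eq)
    qed
    show "(\<forall>a. is_fourier_coeff \<rho> F a \<longrightarrow>
              (\<lambda>n::nat. norm (a (int n))) \<in> O(\<lambda>n. real n powr (k + \<alpha>))) \<and>
           (log_cuspidal \<rho> F \<longrightarrow>
              (\<forall>a. is_fourier_coeff \<rho> F a \<longrightarrow>
                 (\<lambda>n::nat. norm (a (int n))) \<in> O(\<lambda>n. real n powr ((k + \<alpha>) / 2))))"
    proof (intro conjI allI impI)
      fix a assume a: "is_fourier_coeff \<rho> F a"
      obtain C where C: "log_q_expansion \<rho> F C"
          "\<And>c t n. c \<in> set C \<Longrightarrow> t < chain_length c \<Longrightarrow> of_int n + exponent c < 0 \<Longrightarrow> chain_coeff c t n = 0"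
        using F(2) unfolding log_holomorphic_def by blast
      have bnd: "\<exists>K\<ge>0. \<forall>z. 1/2 \<le> Im z \<longrightarrow> norm (h z) \<le> K * (1 / Im z) ^ 0"
        if c: "c \<in> set C" "t < chain_length c"
          and q: "q_series_sums (exponent c) (chain_coeff c t) h" for c t h
      proof -
        have "0 \<le> of_int n + exponent c" if "chain_coeff c t n \<noteq> 0" for n
          using C(2)[OF c, of n] that by force
        then show ?thesis
          by (rule q_series_exp_bound[OF q, of 0]) auto
      qed
      have "\<exists>K\<ge>0. \<forall>z. 1/2 \<le> Im z \<longrightarrow> \<bar>Re z\<bar> \<le> 1/2 \<longrightarrow>
          norm (F z) \<le> K * (Im z ^ p * (1 / Im z) ^ 0)"
        unfolding p_def by (rule vvmf_growth_at_cusp[OF C(1)]) (rule bnd)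
      then obtain K where K: "0 \<le> K" "\<And>z. 1/2 \<le> Im z \<Longrightarrow> \<bar>Re z\<bar> \<le> 1/2 \<Longrightarrow>
          norm (F z) \<le> K * (Im z ^ p * (1 / Im z) ^ 0)"
        by blast
      show "(\<lambda>n::nat. norm (a (int n))) \<in> O(\<lambda>n. real n powr (k + \<alpha>))"
      proof (cases "k + \<alpha> < 0")
        case True
        \<comment> \<open>A negative power of \<open>Im z\<close> is bounded because
          \<open>Im z \<ge> 1/2\<close>. What remains is the power \<open>e\<close> of
          \<open>1 / Im \<tau>\<close>, and \<open>e\<close> is negative too, so all coefficients
          vanish.\<close>
        then have e: "e + real p < 0" by (simp add: e_def \<alpha>_def)
        have "norm (F \<tau>) \<le> (K * (1/2) powr (e + real p)) * (1 / Im \<tau>) powr e"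
          if \<tau>: "\<bar>Re \<tau>\<bar> \<le> 1/2" "0 < Im \<tau>" "Im \<tau> \<le> 1" for \<tau>
        proof -
          obtain z where z: "1/2 \<le> Im z"
            "norm (F \<tau>) \<le> K * ((1 / Im \<tau>) powr e * Im z powr (e + real p))"
            using reduce[OF K \<tau>] by auto
          note z(2)
          also have "K * ((1 / Im \<tau>) powr e * Im z powr (e + real p))
              \<le> K * ((1 / Im \<tau>) powr e * (1/2) powr (e + real p))"
            using e z(1) K(1) by (intro mult_left_mono powr_le_half_powr) auto
          finally show ?thesis by (simp add: mult_ac)
        qed
        then have "a n = 0" for n
          by (rule fourier_coeff_eq_0_of_strip_bound[OF a]) (use e in auto)
        then show ?thesis by simp
      next
        case False
        \<comment> \<open>Now the power of \<open>Im z\<close> is controlled from above by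
          \<open>Im z \<le> 1 / Im \<tau>\<close>.\<close>
        then have e: "0 \<le> e + real p" by (simp add: e_def \<alpha>_def)
        have "norm (F \<tau>) \<le> K * (1 / Im \<tau>) powr (e + (e + real p))"
          if \<tau>: "\<bar>Re \<tau>\<bar> \<le> 1/2" "0 < Im \<tau>" "Im \<tau> \<le> 1" for \<tau>
        proof -
          obtain z where z: "1/2 \<le> Im z" "Im z \<le> 1 / Im \<tau>"
            "norm (F \<tau>) \<le> K * ((1 / Im \<tau>) powr e * Im z powr (e + real p))"
            using reduce[OF K \<tau>] by auto
          note z(3)
          also have "K * ((1 / Im \<tau>) powr e * Im z powr (e + real p))
              \<le> K * ((1 / Im \<tau>) powr e * (1 / Im \<tau>) powr (e + real p))"
            using e z(1,2) K(1) by (intro mult_left_mono powr_mono2) auto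
          finally show ?thesis unfolding powr_add .
        qed
        then show ?thesis
          by (rule bigo_powr_of_strip_bound[OF a]) (auto simp: e_def \<alpha>_def)
      qed
    next
      fix a assume "log_cuspidal \<rho> F" and a: "is_fourier_coeff \<rho> F a"
      then obtain C where C: "log_q_expansion \<rho> F C"
          "\<And>c t n. c \<in> set C \<Longrightarrow> t < chain_length c \<Longrightarrow> of_int n + exponent c \<le> 0 \<Longrightarrow> chain_coeff c t n = 0"
        unfolding log_cuspidal_def by blast
      \<comment> \<open>The decay rate is chosen so that the total exponent of \<open>Im z\<close>
        is at most 0; then \<open>Im z \<ge> 1/2\<close> suffices and only the power
        \<open>e\<close> of \<open>1 / Im \<tau>\<close> survives.\<close>
      define N where "N = nat \<lceil>e + real p\<rceil>"
      have N: "e + real p - real N \<le> 0" unfolding N_def by linarith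
      have bnd: "\<exists>K\<ge>0. \<forall>z. 1/2 \<le> Im z \<longrightarrow> norm (h z) \<le> K * (1 / Im z) ^ N"
        if c: "c \<in> set C" "t < chain_length c"
          and q: "q_series_sums (exponent c) (chain_coeff c t) h" for c t h
        by (rule q_series_cuspidal_bound[OF q C(2)[OF c], of N]) auto
      have "\<exists>K\<ge>0. \<forall>z. 1/2 \<le> Im z \<longrightarrow> \<bar>Re z\<bar> \<le> 1/2 \<longrightarrow>
          norm (F z) \<le> K * (Im z ^ p * (1 / Im z) ^ N)"
        unfolding p_def by (rule vvmf_growth_at_cusp[OF C(1)]) (rule bnd)
      then obtain K where K: "0 \<le> K" "\<And>z. 1/2 \<le> Im z \<Longrightarrow> \<bar>Re z\<bar> \<le> 1/2 \<Longrightarrow>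
          norm (F z) \<le> K * (Im z ^ p * (1 / Im z) ^ N)"
        by blast
      have "norm (F \<tau>) \<le> (K * (1/2) powr (e + real p - real N)) * (1 / Im \<tau>) powr e"
        if \<tau>: "\<bar>Re \<tau>\<bar> \<le> 1/2" "0 < Im \<tau>" "Im \<tau> \<le> 1" for \<tau>
      proof -
        obtain z where z: "1/2 \<le> Im z"
          "norm (F \<tau>) \<le> K * ((1 / Im \<tau>) powr e * Im z powr (e + real p - real N))"
          using reduce[OF K \<tau>] by auto
        note z(2)
        also have "K * ((1 / Im \<tau>) powr e * Im z powr (e + real p - real N))
            \<le> K * ((1 / Im \<tau>) powr e * (1/2) powr (e + real p - real N))"
          using N z(1) K(1) by (intro mult_left_mono powr_le_half_powr) auto
        finally show ?thesis by (simp add: mult_ac)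
      qed
      then show "(\<lambda>n::nat. norm (a (int n))) \<in> O(\<lambda>n. real n powr ((k + \<alpha>) / 2))"
        by (rule bigo_powr_of_strip_bound[OF a]) (auto simp: e_def \<alpha>_def)
    qed
  qed
qed

end
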